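(* Let $d\ge1$ and $s>2$. There exists $p_0>2$ depending only on $(s,d)$ such that for every $p\in[p_0,\infty)$ the following hold. (i) There is $f\in C_c^\infty(\mathbb R^d,\mathbb R)$ with \[ \int_{\mathbb R^d}(\Lambda^s f)\,|f|^{p-2}f\,dx\le -C_{p,d,s}<0, \] where $C_{p,d,s}>0$ depends only on $(p,d,s)$. (ii) There exist constants $D_1,D_2,\alpha_1,\alpha_2>0$ depending on $(p,d,s)$, a sequence $N_j\to\infty$, and real-valued Schwartz functions $f_j:\mathbb R^d\to\mathbb R$ with $\mathrm{supp}(\widehat{f_j})\subset\{\xi:\ \alpha_1N_j<|\xi|<\alpha_2N_j\}$ such that \[ -D_2<\frac{\int_{\mathbb R^d}(\Lambda^s f_j)\,|f_j|^{p-2}f_j\,dx}{N_j^s\int_{\mathbb R^d}|f_j|^p\,dx}<-D_1<0 . \]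
   Context: The Fourier transform on $\mathbb R^d$ is $\widehat f(\xi)=\int_{\mathbb R^d}f(x)e^{-i\xi\cdot x}dx$. For $s>0$, $\Lambda^s=(-\Delta)^{s/2}$ is the Fourier multiplier operator $\widehat{\Lambda^s f}(\xi)=|\xi|^s\widehat f(\xi)$. *)

theory Defs
  imports "HOL-Analysis.Analysis"
begin

fun iter_deriv :: "'a::euclidean_space list \<Rightarrow> ('a \<Rightarrow> real) \<Rightarrow> 'a \<Rightarrow> real" where
  "iter_deriv [] f = f"
| "iter_deriv (v # vs) f = (\<lambda>x. frechet_derivative (iter_deriv vs f) (at x) v)"

definition smooth_fun :: "('a::euclidean_space \<Rightarrow> real) \<Rightarrow> bool" where
  "smooth_fun f \<longleftrightarrow> (\<forall>vs. set vs \<subseteq> Basis \<longrightarrow> (\<forall>x. iter_deriv vs f differentiable (at x)))"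

definition fsupport :: "('a::real_normed_vector \<Rightarrow> 'b::zero) \<Rightarrow> 'a set" where
  "fsupport f = closure {x. f x \<noteq> 0}"

definition Cc_infty :: "('a::euclidean_space \<Rightarrow> real) \<Rightarrow> bool" where
  "Cc_infty f \<longleftrightarrow> smooth_fun f \<and> compact (fsupport f)"

definition schwartz :: "('a::euclidean_space \<Rightarrow> real) \<Rightarrow> bool" where
  "schwartz f \<longleftrightarrow> smooth_fun f \<and>
     (\<forall>vs m. set vs \<subseteq> Basis \<longrightarrow> bounded (range (\<lambda>x. norm x ^ m * iter_deriv vs f x)))"

definition fourier :: "('a::euclidean_space \<Rightarrow> real) \<Rightarrow> 'a \<Rightarrow> complex" where
  "fourier f \<xi> = (\<integral>x. complex_of_real (f x) * cis (- (\<xi> \<bullet> x)) \<partial>lborel)"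

text \<open>Lambda^s f = inverse Fourier transform of |xi|^s hat f; for real f this is real,
  so we take the real part.\<close>
definition frac_lap :: "real \<Rightarrow> ('a::euclidean_space \<Rightarrow> real) \<Rightarrow> 'a \<Rightarrow> real" where
  "frac_lap s f x = Re ((\<integral>\<xi>. complex_of_real (norm \<xi> powr s) * fourier f \<xi> * cis (\<xi> \<bullet> x) \<partial>lborel)
                        / complex_of_real ((2 * pi) ^ DIM('a)))"

end

(* The positive maximum principle fails for Lambda^s with s > 2 already for the trigonometric
   polynomial cos t - eps cos (k t) with eps = 1/(2 k^2): its modulus is maximal at t = 0 (for k odd),
   but Lambda^s multiplies the second term by k^s, so its value at 0 becomes 1 - k^(s-2)/2 < 0 for
   large k. Localise this wave in one coordinate direction by an envelope with nonnegative, rapidly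
   decaying Fourier transform; positivity of the latter gives the envelope a strict maximum at 0 and
   preserves the sign of Lambda^s at 0. As p grows, the integral concentrates at the maximum, hence
   is negative. A compactly supported envelope (an autoconvolution of a bump) gives (i); a
   band-limited one (the Fourier transform of a bump), rescaled by N_j, gives (ii). *)
theory Submission
  imports Defs "HOL-Probability.Probability" "HOL-Real_Asymp.Real_Asymp"
begin

section \<open>Smooth and rapidly decreasing functions on the line\<close>

text \<open>The constant \<open>1 / (2 * k^2)\<close> balances two demands. A maximum of
  \<open>cos t - eps * cos (k * t)\<close> at 0 forces \<open>eps * k^2 <= 1\<close>, and for
  integer k half of that bound suffices for all t; the negative contribution at 0 has size
  \<open>eps * k powr s\<close>, which can be made large under this constraint exactly because s >
  2.

  The envelope has to supply strictness, since the modulus of the carrier returns to its maximum at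
  every multiple of pi. As a tensor product of one function on the line it reduces smoothness,
  decay, integrability and Fourier transforms on the whole space to dimension one. Fourier inversion
  is required only there, because the value of \<open>frac_lap\<close> at 0 is directly an integral
  of the weighted transform.

  The concentration argument asks of \<open>frac_lap s f\<close> only continuity, boundedness and a
  negative value at 0; decay at infinity is left to f. The wave, and with it k, is fixed before p,
  which is why the threshold depends on s and the dimension alone.\<close>

definition deriv_seq :: "(nat \<Rightarrow> real \<Rightarrow> real) \<Rightarrow> bool" where
  "deriv_seq D \<longleftrightarrow> (\<forall>n x. (D n has_real_derivative D (Suc n) x) (at x))"

definition smooth1 :: "(real \<Rightarrow> real) \<Rightarrow> bool" where
  "smooth1 f \<longleftrightarrow> (\<exists>D. D 0 = f \<and> deriv_seq D)"

text \<open>The weight \<open>1 + |x|\<close> is at least 1 everywhere, and its product over the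
  coordinates dominates \<open>1 + norm x\<close>, so decay can later be checked factor by
  factor.\<close>

definition rapid :: "(real \<Rightarrow> real) \<Rightarrow> bool" where
  "rapid f \<longleftrightarrow> (\<forall>m::nat. \<exists>B. \<forall>x. (1 + \<bar>x\<bar>) ^ m * \<bar>f x\<bar> \<le> B)"

definition schwartz1 :: "(real \<Rightarrow> real) \<Rightarrow> bool" where
  "schwartz1 f \<longleftrightarrow> (\<exists>D. D 0 = f \<and> deriv_seq D \<and> (\<forall>n. rapid (D n)))"

definition test1 :: "(real \<Rightarrow> real) \<Rightarrow> bool" where
  "test1 f \<longleftrightarrow> smooth1 f \<and> (\<exists>R. \<forall>x. \<bar>x\<bar> > R \<longrightarrow> f x = 0)"

text \<open>Choice turns the closure property into an operator on the class, and its iterates form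
  the derivative sequence. Smoothness proofs thus reduce to guessing a class that contains the
  function and is stable under differentiation; no n-th derivative is ever computed.\<close>

lemma deriv_seq_coinduct:
  assumes "P f" and step: "\<And>f. P f \<Longrightarrow> \<exists>f'. P f' \<and> (\<forall>x. (f has_real_derivative f' x) (at x))"
  obtains D where "D 0 = f" "deriv_seq D" "\<And>n. P (D n)"
proof -
  from step obtain d where d: "\<And>f. P f \<Longrightarrow> P (d f)"
      "\<And>f x. P f \<Longrightarrow> (f has_real_derivative d f x) (at x)"
    by metis
  have P: "P ((d ^^ n) f)" for n
    by (induction n) (auto intro: d \<open>P f\<close>)
  then have "deriv_seq (\<lambda>n. (d ^^ n) f)"
    by (auto simp: deriv_seq_def intro: d)
  with P show ?thesis
    by (intro that[of "\<lambda>n. (d ^^ n) f"]) auto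
qed

lemma smooth1_coinduct:
  assumes "P f" and "\<And>f. P f \<Longrightarrow> \<exists>f'. P f' \<and> (\<forall>x. (f has_real_derivative f' x) (at x))"
  shows "smooth1 f"
  by (rule deriv_seq_coinduct[OF assms]) (auto simp: smooth1_def)

lemma schwartz1_coinduct:
  assumes "P f" and "\<And>f. P f \<Longrightarrow> \<exists>f'. P f' \<and> (\<forall>x. (f has_real_derivative f' x) (at x))"
    and "\<And>f. P f \<Longrightarrow> rapid f"
  shows "schwartz1 f"
  by (rule deriv_seq_coinduct[OF assms(1,2)]) (use assms(3) in \<open>auto simp: schwartz1_def\<close>)

lemma deriv_seq_Suc: "deriv_seq D \<Longrightarrow> deriv_seq (\<lambda>n. D (Suc n))"
  by (auto simp: deriv_seq_def)

lemma smooth1E: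
  assumes "smooth1 f"
  obtains f' where "smooth1 f'" "\<And>x. (f has_real_derivative f' x) (at x)"
proof -
  from assms obtain D where D: "D 0 = f" "deriv_seq D" by (auto simp: smooth1_def)
  have "smooth1 (D 1)"
    unfolding smooth1_def using deriv_seq_Suc[OF D(2)] by (intro exI[of _ "\<lambda>n. D (Suc n)"]) auto
  with D show ?thesis
    by (intro that[of "D 1"]) (auto simp: deriv_seq_def)
qed

lemma smooth1_ex_deriv: "smooth1 f \<Longrightarrow> \<exists>f'. smooth1 f' \<and> (\<forall>x. (f has_real_derivative f' x) (at x))"
  by (rule smooth1E) blast+

lemma schwartz1E:
  assumes "schwartz1 f"
  obtains f' where "schwartz1 f'" "\<And>x. (f has_real_derivative f' x) (at x)"
proof -
  from assms obtain D where D: "D 0 = f" "deriv_seq D" "\<And>n. rapid (D n)"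
    by (auto simp: schwartz1_def)
  have "schwartz1 (D 1)"
    unfolding schwartz1_def using deriv_seq_Suc[OF D(2)] D(3)
    by (intro exI[of _ "\<lambda>n. D (Suc n)"]) auto
  with D show ?thesis
    by (intro that[of "D 1"]) (auto simp: deriv_seq_def)
qed

lemma smooth1_continuous: "smooth1 f \<Longrightarrow> continuous_on S f"
  by (meson smooth1E DERIV_isCont continuous_at_imp_continuous_on)

lemma schwartz1_smooth1: "schwartz1 f \<Longrightarrow> smooth1 f"
  by (auto simp: schwartz1_def smooth1_def)

lemma schwartz1_rapid: "schwartz1 f \<Longrightarrow> rapid f"
  by (auto simp: schwartz1_def)

lemma rapid_add: assumes "rapid f" "rapid g" shows "rapid (\<lambda>x. f x + g x)"
  unfolding rapid_def
proof
  fix m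
  obtain A B where *: "\<And>x. (1 + \<bar>x\<bar>) ^ m * \<bar>f x\<bar> \<le> A" "\<And>x. (1 + \<bar>x\<bar>) ^ m * \<bar>g x\<bar> \<le> B"
    using assms unfolding rapid_def by meson
  have "(1 + \<bar>x\<bar>) ^ m * \<bar>f x + g x\<bar> \<le> A + B" for x
  proof -
    have "(1 + \<bar>x\<bar>) ^ m * \<bar>f x + g x\<bar> \<le> (1 + \<bar>x\<bar>) ^ m * (\<bar>f x\<bar> + \<bar>g x\<bar>)"
      by (intro mult_left_mono) auto
    also have "\<dots> \<le> A + B" using *[of x] by (simp add: distrib_left)
    finally show ?thesis .
  qed
  then show "\<exists>B. \<forall>x. (1 + \<bar>x\<bar>) ^ m * \<bar>f x + g x\<bar> \<le> B" by blast
qed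

lemma rapid_mult_bounded:
  assumes "rapid f" "\<And>x. \<bar>h x\<bar> \<le> C" shows "rapid (\<lambda>x. h x * f x)"
  unfolding rapid_def
proof
  fix m
  obtain A where *: "\<And>x. (1 + \<bar>x\<bar>) ^ m * \<bar>f x\<bar> \<le> A"
    using assms(1) unfolding rapid_def by meson
  have "(1 + \<bar>x\<bar>) ^ m * \<bar>h x * f x\<bar> \<le> C * A" for x
  proof -
    have "0 \<le> C" using assms(2)[of x] by linarith
    have "(1 + \<bar>x\<bar>) ^ m * \<bar>h x * f x\<bar> = \<bar>h x\<bar> * ((1 + \<bar>x\<bar>) ^ m * \<bar>f x\<bar>)"
      by (simp add: abs_mult)
    also have "\<dots> \<le> C * A"
      by (intro mult_mono assms(2) *) (auto simp: \<open>0 \<le> C\<close>)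
    finally show ?thesis .
  qed
  then show "\<exists>B. \<forall>x. (1 + \<bar>x\<bar>) ^ m * \<bar>h x * f x\<bar> \<le> B" by blast
qed

lemma rapid_cmult: "rapid f \<Longrightarrow> rapid (\<lambda>x. c * f x)"
  by (rule rapid_mult_bounded[where C="\<bar>c\<bar>"]) auto

lemma schwartz1_lincomb:
  assumes "schwartz1 f" "schwartz1 g"
  shows "schwartz1 (\<lambda>x. a * f x + b * g x)"
proof (rule schwartz1_coinduct[where P="\<lambda>h. \<exists>f g. schwartz1 f \<and> schwartz1 g \<and> h = (\<lambda>x. a * f x + b * g x)"], goal_cases)
  case 1 then show ?case using assms by blast
next
  case (2 h)
  then obtain f g where h: "schwartz1 f" "schwartz1 g" "h = (\<lambda>x. a * f x + b * g x)" by blast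
  obtain f' g' where d: "schwartz1 f'" "schwartz1 g'"
     "\<And>x. (f has_real_derivative f' x) (at x)" "\<And>x. (g has_real_derivative g' x) (at x)"
    using h schwartz1E by metis
  show ?case unfolding h
  proof (rule exI[of _ "\<lambda>x. a * f' x + b * g' x"], intro conjI allI)
    show "\<exists>f g. schwartz1 f \<and> schwartz1 g \<and> (\<lambda>x. a * f' x + b * g' x) = (\<lambda>x. a * f x + b * g x)"
      using d(1,2) by blast
  qed (intro DERIV_add DERIV_cmult d)
next
  case (3 h)
  then obtain f g where "schwartz1 f" "schwartz1 g" and h: "h = (\<lambda>x. a * f x + b * g x)" by blast
  then show ?case unfolding h by (intro rapid_add rapid_cmult schwartz1_rapid)
qed

text \<open>Differentiation produces a sine term, so the stable class consists of
  \<open>cos (c * x) * f x + sin (c * x) * g x\<close> with f and g both Schwartz; the claim is the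
  case g = 0.\<close>

lemma schwartz1_trig:
  assumes "schwartz1 f"
  shows "schwartz1 (\<lambda>x. cos (c * x) * f x)"
proof (rule schwartz1_coinduct[where P="\<lambda>h. \<exists>f g. schwartz1 f \<and> schwartz1 g \<and> h = (\<lambda>x. cos (c * x) * f x + sin (c * x) * g x)"], goal_cases)
  case 1
  have "schwartz1 (\<lambda>x. 0 * f x + 0 * f x)" by (intro schwartz1_lincomb assms)
  moreover have "(\<lambda>x. cos (c * x) * f x) = (\<lambda>x. cos (c * x) * f x + sin (c * x) * (0 * f x + 0 * f x))"
    by simp
  ultimately show ?case using assms by blast
next
  case (2 h)
  then obtain f g where h: "schwartz1 f" "schwartz1 g" "h = (\<lambda>x. cos (c * x) * f x + sin (c * x) * g x)" by blast
  obtain f' g' where d: "schwartz1 f'" "schwartz1 g'"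
     "\<And>x. (f has_real_derivative f' x) (at x)" "\<And>x. (g has_real_derivative g' x) (at x)"
    using h schwartz1E by metis
  have "schwartz1 (\<lambda>x. 1 * f' x + c * g x)" "schwartz1 (\<lambda>x. 1 * g' x + (-c) * f x)"
    by (intro schwartz1_lincomb d h)+
  moreover have "(h has_real_derivative (cos (c*x) * (1 * f' x + c * g x) + sin (c*x) * (1 * g' x + (-c) * f x))) (at x)" for x
    unfolding h by (auto intro!: derivative_eq_intros d simp: algebra_simps)
  ultimately show ?case by blast
next
  case (3 h)
  then obtain f g where "schwartz1 f" "schwartz1 g"
    and h: "h = (\<lambda>x. cos (c * x) * f x + sin (c * x) * g x)" by blast
  then show ?case
    unfolding h by (intro rapid_add rapid_mult_bounded[where C=1] schwartz1_rapid) auto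
qed

lemma rapid_scale:
  assumes "rapid f" "N \<ge> 1" shows "rapid (\<lambda>x. f (N * x))"
  unfolding rapid_def
proof
  fix m
  obtain A where *: "\<And>x. (1 + \<bar>x\<bar>) ^ m * \<bar>f x\<bar> \<le> A"
    using assms(1) unfolding rapid_def by meson
  have "(1 + \<bar>x\<bar>) ^ m * \<bar>f (N * x)\<bar> \<le> A" for x
  proof -
    have "\<bar>x\<bar> \<le> \<bar>N * x\<bar>" using assms(2) by (simp add: abs_mult mult_le_cancel_right1)
    then have "(1 + \<bar>x\<bar>) ^ m * \<bar>f (N * x)\<bar> \<le> (1 + \<bar>N * x\<bar>) ^ m * \<bar>f (N * x)\<bar>"
      by (intro mult_right_mono power_mono) auto
    with *[of "N * x"] show ?thesis by linarith
  qed
  then show "\<exists>B. \<forall>x. (1 + \<bar>x\<bar>) ^ m * \<bar>f (N * x)\<bar> \<le> B" by blast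
qed

lemma schwartz1_scale:
  assumes "schwartz1 f" "N \<ge> 1"
  shows "schwartz1 (\<lambda>x. f (N * x))"
proof (rule schwartz1_coinduct[where P="\<lambda>h. \<exists>f. schwartz1 f \<and> h = (\<lambda>x. f (N * x))"], goal_cases)
  case 1 then show ?case using assms by blast
next
  case (2 h)
  then obtain f where h: "schwartz1 f" "h = (\<lambda>x. f (N * x))" by blast
  obtain f' where d: "schwartz1 f'" "\<And>x. (f has_real_derivative f' x) (at x)"
    using h schwartz1E by metis
  have "schwartz1 (\<lambda>x. N * f' x + 0 * f' x)" by (intro schwartz1_lincomb d)
  moreover have "(h has_real_derivative (N * f' (N * x) + 0 * f' (N*x))) (at x)" for x
  proof -
    have "((\<lambda>x. f (N * x)) has_real_derivative f' (N * x) * N) (at x)"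
      by (rule DERIV_chain2[OF d(2)]) (rule DERIV_cmult_Id)
    then show ?thesis unfolding h by (simp add: mult.commute)
  qed
  ultimately show ?case by blast
next
  case (3 h)
  then obtain f where "schwartz1 f" and h: "h = (\<lambda>x. f (N * x))" by blast
  then show ?case using assms(2) unfolding h by (intro rapid_scale schwartz1_rapid)
qed

section \<open>Closure properties of smooth functions on the line\<close>

text \<open>Single products are not stable under differentiation, but finite sums of products are;
  hence the class of sums of arbitrary length n.\<close>

lemma smooth1_mult:
  assumes "smooth1 f" "smooth1 g"
  shows "smooth1 (\<lambda>x. f x * g x)"
proof -
  let ?P = "\<lambda>h. \<exists>(F::nat \<Rightarrow> real \<Rightarrow> real) G n. (\<forall>i. smooth1 (F i) \<and> smooth1 (G i)) \<and> h = (\<lambda>x. \<Sum>i<n. F i x * G i x)"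
  show ?thesis
  proof (rule smooth1_coinduct[where P="?P"], goal_cases)
    case 1
    show ?case by (rule exI[of _ "\<lambda>_. f"], rule exI[of _ "\<lambda>_. g"], rule exI[of _ 1]) (use assms in auto)
  next
    case (2 h)
    then obtain F G :: "nat \<Rightarrow> real \<Rightarrow> real" and n where h: "\<And>i. smooth1 (F i)" "\<And>i. smooth1 (G i)" "h = (\<lambda>x. \<Sum>i<n. F i x * G i x)"
      by blast
    obtain F' where F': "\<And>i. smooth1 (F' i)" "\<And>i x. (F i has_real_derivative F' i x) (at x)"
      using smooth1_ex_deriv[OF h(1)] by metis
    obtain G' where G': "\<And>i. smooth1 (G' i)" "\<And>i x. (G i has_real_derivative G' i x) (at x)"
      using smooth1_ex_deriv[OF h(2)] by metis
    \<comment> \<open>The product rule doubles the number of terms: the first n carry the derivative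
      on F, the last n on G.\<close>
    define A where "A i = (if i < n then F' i else F (i - n))" for i
    define B where "B i = (if i < n then G i else G' (i - n))" for i
    have eq: "(\<Sum>i<2*n. A i x * B i x) = (\<Sum>i<n. F' i x * G i x + F i x * G' i x)" for x
    proof -
      have "(\<Sum>i<2*n. A i x * B i x) = (\<Sum>i<n. A i x * B i x) + (\<Sum>i\<in>{n..<n+n}. A i x * B i x)"
        by (simp add: mult_2 lessThan_atLeast0 sum.atLeastLessThan_concat)
      also have "(\<Sum>i\<in>{n..<n+n}. A i x * B i x) = (\<Sum>i\<in>{0..<n}. A (i + n) x * B (i + n) x)"
        using sum.shift_bounds_nat_ivl[of "\<lambda>i. A i x * B i x" 0 n n] by simp
      finally show ?thesis
        by (simp add: A_def B_def sum.distrib lessThan_atLeast0)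
    qed
    have "(h has_real_derivative (\<Sum>i<2*n. A i x * B i x)) (at x)" for x
      unfolding h eq by (auto intro!: derivative_eq_intros F' G' sum.cong)
    moreover have "\<And>i. smooth1 (A i)" "\<And>i. smooth1 (B i)"
      using h F' G' by (auto simp: A_def B_def)
    ultimately show ?case by blast
  qed
qed

lemma smooth1_const [simp]: "smooth1 (\<lambda>x. c)"
proof (rule smooth1_coinduct[where P="\<lambda>h. \<exists>c. h = (\<lambda>x. c)"], goal_cases)
  case (2 h)
  then have "(h has_real_derivative 0) (at x)" for x by auto
  then show ?case by (intro exI[of _ "\<lambda>_. 0"]) auto
qed blast

lemma smooth1_affine: "smooth1 (\<lambda>x. a * x + b)"
proof (rule smooth1_coinduct[where P="\<lambda>h. \<exists>a b. h = (\<lambda>x. a * x + b)"], goal_cases)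
  case (2 h)
  then obtain a b where h: "h = (\<lambda>x. a * x + b)" by blast
  have "(h has_real_derivative 0 * x + a) (at x)" for x
    unfolding h by (auto intro!: derivative_eq_intros)
  then show ?case by blast
qed blast

lemma smooth1_compose_affine:
  assumes "smooth1 f" shows "smooth1 (\<lambda>x. f (a * x + b))"
proof (rule smooth1_coinduct[where P="\<lambda>h. \<exists>f c. smooth1 f \<and> h = (\<lambda>x. c * f (a * x + b))"], goal_cases)
  case 1 then show ?case using assms by (auto intro!: exI[of _ f] exI[of _ 1])
next
  case (2 h)
  then obtain f c where h: "smooth1 f" "h = (\<lambda>x. c * f (a * x + b))" by blast
  obtain f' where d: "smooth1 f'" "\<And>x. (f has_real_derivative f' x) (at x)"
    using h smooth1E by metis
  have "(h has_real_derivative ((c * a) * f' (a * x + b))) (at x)" for x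
    unfolding h by (auto intro!: derivative_eq_intros DERIV_chain2[OF d(2)])
  with d show ?case by blast
qed

section \<open>Smooth functions of compact support\<close>

lemma test1_mult:
  assumes "smooth1 f" "test1 g" shows "test1 (\<lambda>x. f x * g x)"
proof -
  from assms obtain R where "\<And>x. \<bar>x\<bar> > R \<Longrightarrow> g x = 0" by (auto simp: test1_def)
  then have "\<forall>x. \<bar>x\<bar> > R \<longrightarrow> f x * g x = 0" by simp
  with assms show ?thesis by (auto simp: test1_def intro!: smooth1_mult)
qed

lemma test1_smooth1: "test1 f \<Longrightarrow> smooth1 f" by (simp add: test1_def)

text \<open>The derivative inherits the same support bound, because beyond R the function is 0 on an
  open set and derivatives are unique.\<close>

lemma test1E:
  assumes "test1 f"
  obtains f' where "test1 f'" "\<And>x. (f has_real_derivative f' x) (at x)"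
proof -
  from assms obtain f' where d: "smooth1 f'" "\<And>x. (f has_real_derivative f' x) (at x)"
    by (meson test1_smooth1 smooth1E)
  from assms obtain R where R: "\<And>x. \<bar>x\<bar> > R \<Longrightarrow> f x = 0" by (auto simp: test1_def)
  have "f' x = 0" if x: "\<bar>x\<bar> > R" for x
  proof -
    have "open {x::real. \<bar>x\<bar> > R}" by (intro open_Collect_less continuous_intros)
    then have "((\<lambda>_. 0) has_real_derivative f' x) (at x)"
      by (rule has_field_derivative_transform_within_open[OF d(2)[of x]]) (use R x in auto)
    from DERIV_unique[OF this DERIV_const] show ?thesis .
  qed
  with d show ?thesis by (intro that[of f']) (auto simp: test1_def)
qed

lemma test1_rapid:
  assumes "test1 f" shows "rapid f"
  unfolding rapid_def
proof
  fix m
  obtain R where R: "\<And>x. \<bar>x\<bar> > R \<Longrightarrow> f x = 0" using assms by (auto simp: test1_def)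
  have "compact ((\<lambda>x. (1 + \<bar>x\<bar>) ^ m * \<bar>f x\<bar>) ` {-\<bar>R\<bar>..\<bar>R\<bar>})"
    by (intro compact_continuous_image continuous_intros smooth1_continuous test1_smooth1 assms) auto
  then have "bounded ((\<lambda>x. (1 + \<bar>x\<bar>) ^ m * \<bar>f x\<bar>) ` {-\<bar>R\<bar>..\<bar>R\<bar>})" by (rule compact_imp_bounded)
  then obtain B where B: "\<forall>y\<in>(\<lambda>x. (1 + \<bar>x\<bar>) ^ m * \<bar>f x\<bar>) ` {-\<bar>R\<bar>..\<bar>R\<bar>}. norm y \<le> B"
    unfolding bounded_iff by blast
  have "(1 + \<bar>x\<bar>) ^ m * \<bar>f x\<bar> \<le> \<bar>B\<bar>" for x
  proof (cases "x \<in> {-\<bar>R\<bar>..\<bar>R\<bar>}")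
    case True
    from bspec[OF B imageI[OF this]] show ?thesis by simp
  next
    case False
    then have "f x = 0" by (intro R) auto
    then show ?thesis by simp
  qed
  then show "\<exists>B. \<forall>x. (1 + \<bar>x\<bar>) ^ m * \<bar>f x\<bar> \<le> B" by (intro exI allI)
qed

lemma test1_schwartz1:
  assumes "test1 f" shows "schwartz1 f"
proof (rule schwartz1_coinduct[where P=test1 and f=f])
  fix f assume "test1 f"
  then obtain f' where f': "test1 f'" "\<And>x. (f has_real_derivative f' x) (at x)"
    by (rule test1E) blast
  show "\<exists>f'. test1 f' \<and> (\<forall>x. (f has_real_derivative f' x) (at x))"
    by (intro exI[of _ f'] conjI allI f')
next
  fix f assume "test1 f" then show "rapid f" by (rule test1_rapid)
qed (rule assms)

section \<open>Integrals of compactly supported and of rapidly decreasing functions\<close>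

text \<open>A bridge from the Lebesgue integral over the line to the gauge integral over an
  interval, where the Leibniz rule and the fundamental theorem of calculus are available.\<close>

lemma lborel_integral_compact_support:
  fixes h :: "real \<Rightarrow> real"
  assumes c: "continuous_on UNIV h" and z: "\<And>x. \<bar>x\<bar> > R \<Longrightarrow> h x = 0"
  shows "integrable lborel h" "(\<integral>x. h x \<partial>lborel) = integral {-R..R} h"
proof -
  have eq: "h = (\<lambda>x. indicator {-R..R} x *\<^sub>R h x)"
    using z by (auto simp: indicator_def fun_eq_iff abs_le_iff not_le[symmetric] minus_le_iff)
  have i: "set_integrable lborel {-R..R} h"
    by (intro borel_integrable_atLeastAtMost' continuous_on_subset[OF c]) auto
  then show "integrable lborel h" unfolding set_integrable_def eq[symmetric] .
  have "(\<integral>x. h x \<partial>lborel) = (LINT x:{-R..R}|lborel. h x)"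
    unfolding set_lebesgue_integral_def eq[symmetric] ..
  also have "\<dots> = integral {-R..R} h" by (rule set_borel_integral_eq_integral[OF i])
  finally show "(\<integral>x. h x \<partial>lborel) = integral {-R..R} h" .
qed

text \<open>The support of the kernel in t is bounded uniformly in x, so the Leibniz rule on the
  fixed interval from -R to R applies. This serves both the trigonometric transforms and the
  convolutions.\<close>

lemma has_derivative_under_lborel:
  fixes K K' :: "real \<Rightarrow> real \<Rightarrow> real"
  assumes d: "\<And>x t. ((\<lambda>x. K x t) has_real_derivative K' x t) (at x)"
    and c': "continuous_on UNIV (\<lambda>(x, t). K' x t)" and c: "\<And>x. continuous_on UNIV (K x)"
    and z: "\<And>x t. \<bar>t\<bar> > R \<Longrightarrow> K x t = 0" "\<And>x t. \<bar>t\<bar> > R \<Longrightarrow> K' x t = 0"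
  shows "((\<lambda>x. \<integral>t. K x t \<partial>lborel) has_real_derivative (\<integral>t. K' x t \<partial>lborel)) (at x)"
proof -
  have c'': "continuous_on UNIV (K' x)" for x
    by (rule continuous_on_compose2[OF c', of UNIV "\<lambda>t. (x, t)", simplified])
       (intro continuous_intros)
  have "((\<lambda>x. integral (cbox (-R) R) (K x)) has_real_derivative integral (cbox (-R) R) (K' x)) (at x within UNIV)"
    by (rule leibniz_rule_field_derivative)
       (auto intro!: d integrable_continuous_interval continuous_on_subset[OF c] continuous_on_subset[OF c'])
  then show ?thesis
    using lborel_integral_compact_support(2)[OF c z(1)] lborel_integral_compact_support(2)[OF c'' z(2)]
    by simp
qed

lemma lborel_integral_deriv_compact_support:
  fixes F F' :: "real \<Rightarrow> real"
  assumes d: "\<And>x. (F has_real_derivative F' x) (at x)"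
    and c: "continuous_on UNIV F'" and z: "\<And>x. \<bar>x\<bar> > R \<Longrightarrow> F x = 0"
  shows "(\<integral>x. F' x \<partial>lborel) = 0"
proof -
  \<comment> \<open>The support bound speaks only about points strictly beyond R, and R may be
    negative; this S makes F vanish at both endpoints of a nonempty interval.\<close>
  define S where "S = \<bar>R\<bar> + 1"
  have z': "F' x = 0" if x: "\<bar>x\<bar> > S" for x
  proof -
    have "open {x::real. \<bar>x\<bar> > S}" by (intro open_Collect_less continuous_intros)
    then have "((\<lambda>_. 0) has_real_derivative F' x) (at x)"
      by (rule has_field_derivative_transform_within_open[OF d[of x]]) (use z x in \<open>auto simp: S_def\<close>)
    from DERIV_unique[OF this DERIV_const] show ?thesis .
  qed
  have "(F' has_integral (F S - F (-S))) {-S..S}"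
    by (rule fundamental_theorem_of_calculus)
       (auto simp: S_def has_real_derivative_iff_has_vector_derivative[symmetric]
             intro: has_field_derivative_at_within d)
  then have "integral {-S..S} F' = F S - F (-S)" by (rule integral_unique)
  also have "\<dots> = 0" using z[of S] z[of "-S"] by (simp add: S_def)
  finally show ?thesis using lborel_integral_compact_support(2)[OF c z'] by simp
qed

text \<open>A vanishing integral would make the open set where h is nonzero a null set, and an open
  null set is empty.\<close>

lemma integral_continuous_pos:
  fixes h :: "'a::euclidean_space \<Rightarrow> real"
  assumes c: "continuous_on UNIV h" and i: "integrable lborel h" and nn: "\<And>x. h x \<ge> 0" and p: "h x0 > 0"
  shows "(\<integral>x. h x \<partial>lborel) > 0"
proof (rule ccontr)
  assume "\<not> ?thesis"
  moreover have "(\<integral>x. h x \<partial>lborel) \<ge> 0" by (intro integral_nonneg_AE) (auto simp: nn)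
  ultimately have "(\<integral>x. h x \<partial>lborel) = 0" by simp
  then have "AE x in lborel. h x = 0"
    using integral_nonneg_eq_0_iff_AE[OF i] nn by auto
  moreover have o: "open {x. h x \<noteq> 0}" using c by (intro open_Collect_neq continuous_intros)
  ultimately have "{x. h x \<noteq> 0} \<in> null_sets lborel"
    using AE_iff_null[of lborel "\<lambda>x. h x = 0"] by simp
  then have "negligible {x. h x \<noteq> 0}"
    by (simp add: negligible_iff_null_sets null_sets_completionI)
  with open_not_negligible[OF o] have "{x. h x \<noteq> 0} = {}" by blast
  moreover have "x0 \<in> {x. h x \<noteq> 0}" using p by simp
  ultimately show False by blast
qed

lemma rapid_bounded: assumes "rapid f" obtains B where "\<And>x. \<bar>f x\<bar> \<le> B"
  using assms unfolding rapid_def by (metis mult_1 power_0)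

lemma rapid_measurable_integrable:
  assumes r: "rapid f" and m[measurable]: "f \<in> borel_measurable borel"
  shows "integrable lborel (\<lambda>x. (1 + \<bar>x\<bar>) ^ k * \<bar>f x\<bar>)"
proof -
  \<comment> \<open>Two extra powers of the weight are spent on the integrable majorant
    \<open>1 / (1 + x^2)\<close>.\<close>
  obtain B where B: "\<And>x. (1 + \<bar>x\<bar>) ^ (k + 2) * \<bar>f x\<bar> \<le> B" using r unfolding rapid_def by meson
  have i: "integrable lborel (\<lambda>x::real. B * inverse (1 + x\<^sup>2))"
    using integrable_inverse_1_plus_square
    by (intro integrable_mult_right) (simp add: set_integrable_def einterval_eq_UNIV)
  show ?thesis
  proof (rule Bochner_Integration.integrable_bound[OF i])
    show "AE x in lborel. norm ((1 + \<bar>x\<bar>) ^ k * \<bar>f x\<bar>) \<le> norm (B * inverse (1 + x\<^sup>2))"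
    proof (rule AE_I2)
      fix x :: real
      have "0 \<le> B" using B[of 0] by (smt (verit) abs_ge_zero mult_nonneg_nonneg zero_le_power)
      have "(1 + x\<^sup>2) * ((1 + \<bar>x\<bar>) ^ k * \<bar>f x\<bar>) \<le> (1 + \<bar>x\<bar>)\<^sup>2 * ((1 + \<bar>x\<bar>) ^ k * \<bar>f x\<bar>)"
        by (intro mult_right_mono) (auto simp: power2_sum)
      also have "\<dots> = (1 + \<bar>x\<bar>) ^ (k + 2) * \<bar>f x\<bar>" by (simp add: power_add power2_eq_square ac_simps)
      also have "\<dots> \<le> B" by (rule B)
      finally show "norm ((1 + \<bar>x\<bar>) ^ k * \<bar>f x\<bar>) \<le> norm (B * inverse (1 + x\<^sup>2))"
        using \<open>0 \<le> B\<close> by (simp add: abs_mult field_simps add_pos_nonneg)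
    qed
  qed measurable
qed

lemma rapid_integrable:
  assumes r: "rapid f" and m: "continuous_on UNIV f"
  shows "integrable lborel f"
proof -
  have m[measurable]: "f \<in> borel_measurable borel" using m by (rule borel_measurable_continuous_onI)
  show ?thesis
    by (rule Bochner_Integration.integrable_bound[OF rapid_measurable_integrable[OF r m, of 0]]) auto
qed

section \<open>Fourier inversion on the line\<close>

text \<open>With \<open>t = n * z\<close> this is the characteristic function of the standard normal
  distribution at \<open>s * n\<close>. It provides the explicit kernel for the inversion
  formula.\<close>

lemma gaussian_cis_integral:
  assumes "n > 0"
  shows "(\<integral>t. cis (s * t) * complex_of_real (exp (- (t / n)\<^sup>2 / 2)) \<partial>lborel)
         = complex_of_real (n * sqrt (2 * pi) * exp (- (s * n)\<^sup>2 / 2))"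
proof -
  have "(\<integral>t. cis (s * t) * complex_of_real (exp (- (t / n)\<^sup>2 / 2)) \<partial>lborel)
      = n *\<^sub>R (\<integral>z. cis (s * (0 + n * z)) * complex_of_real (exp (- ((0 + n * z) / n)\<^sup>2 / 2)) \<partial>lborel)"
    using assms by (subst lborel_integral_real_affine[where c=n and t=0]) auto
  also have "(\<integral>z. cis (s * (0 + n * z)) * complex_of_real (exp (- ((0 + n * z) / n)\<^sup>2 / 2)) \<partial>lborel)
     = (\<integral>z. complex_of_real (sqrt (2 * pi)) * (std_normal_density z *\<^sub>R iexp ((s * n) * z)) \<partial>lborel)"
  proof (rule Bochner_Integration.integral_cong[OF refl])
    fix z
    have 1: "exp (- ((0 + n * z) / n)\<^sup>2 / 2) = sqrt (2 * pi) * std_normal_density z"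
      using assms by (simp add: std_normal_density_def)
    have 2: "cis (s * (0 + n * z)) = iexp ((s * n) * z)"
      by (simp add: cis_conv_exp mult.assoc)
    show "cis (s * (0 + n * z)) * complex_of_real (exp (- ((0 + n * z) / n)\<^sup>2 / 2))
        = complex_of_real (sqrt (2 * pi)) * (std_normal_density z *\<^sub>R iexp ((s * n) * z))"
      unfolding 1 2 scaleR_conv_of_real of_real_mult by (simp only: ac_simps)
  qed
  also have "\<dots> = complex_of_real (sqrt (2 * pi)) * char std_normal_distribution (s * n)"
  proof -
    have "char std_normal_distribution (s * n) = (\<integral>z. std_normal_density z *\<^sub>R iexp ((s * n) * z) \<partial>lborel)"
      unfolding char_def
      by (rule integral_density) auto
    then show ?thesis by (simp only: integral_mult_right_zero)
  qed
  also have "n *\<^sub>R \<dots> = complex_of_real (n * sqrt (2 * pi) * exp (- (s * n)\<^sup>2 / 2))"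
    by (simp add: char_std_normal_distribution scaleR_conv_of_real)
  finally show ?thesis .
qed

lemma gaussian_integrable: "n > 0 \<Longrightarrow> integrable lborel (\<lambda>t::real. exp (- (t / n)\<^sup>2 / 2))"
proof -
  assume n: "n > 0"
  have "integrable lborel (\<lambda>t. sqrt (2 * pi) * std_normal_density (0 + (1 / n) * t))"
    using n by (intro integrable_mult_right lborel_integrable_real_affine integrable_normal_density) auto
  then show ?thesis by (simp add: std_normal_density_def)
qed

lemma integrable_mult_cis:
  assumes "integrable M (f :: 'a \<Rightarrow> complex)" and [measurable]: "g \<in> borel_measurable M"
  shows "integrable M (\<lambda>x. f x * cis (g x))"
proof (rule Bochner_Integration.integrable_bound[OF assms(1)])
  have [measurable]: "cis \<in> borel_measurable borel"
    by (intro borel_measurable_continuous_onI continuous_intros)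
  have [measurable]: "f \<in> borel_measurable M" using assms(1) by auto
  show "(\<lambda>x. f x * cis (g x)) \<in> borel_measurable M" by measurable
qed (auto simp: norm_mult)

text \<open>Gaussian summation. With the cutoff \<open>G n\<close> under the integral, dominated
  convergence yields the left-hand side in the limit. On the other hand, Fubini and the explicit
  Gaussian transform turn the same integral into an average of f over a Gaussian of width
  \<open>1 / Suc n\<close> around x, which converges by continuity and boundedness of f.\<close>

lemma fourier_inversion:
  fixes f :: "real \<Rightarrow> real"
  assumes c: "continuous_on UNIV f" and B: "\<And>x. \<bar>f x\<bar> \<le> B"
    and i: "integrable lborel f" and iF: "integrable lborel (fourier f)"
  shows "(\<integral>t. fourier f t * cis (x * t) \<partial>lborel) = complex_of_real (2 * pi * f x)"
proof -
  define G :: "nat \<Rightarrow> real \<Rightarrow> real" where "G n t = exp (- (t / real (Suc n))\<^sup>2 / 2)" for n t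
  have [measurable]: "f \<in> borel_measurable borel" using c by (rule borel_measurable_continuous_onI)
  have cm[measurable]: "cis \<in> borel_measurable borel"
    by (intro borel_measurable_continuous_onI continuous_intros)
  have [measurable]: "G n \<in> borel_measurable borel" for n unfolding G_def by measurable
  have [measurable]: "fourier f \<in> borel_measurable borel" using iF by auto
  have G1: "\<bar>G n t\<bar> \<le> 1" "G n t \<ge> 0" for n t by (auto simp: G_def)
  have Glim: "(\<lambda>n. G n t) \<longlonglongrightarrow> 1" for t
  proof -
    have "(\<lambda>n. exp (- (t * inverse (real (Suc n)))\<^sup>2 / 2)) \<longlonglongrightarrow> exp (- (t * 0)\<^sup>2 / 2)"
      by (intro tendsto_intros LIMSEQ_inverse_real_of_nat) auto
    moreover have "t / real (Suc n) = t * inverse (real (Suc n))" for n by (rule divide_inverse)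
    ultimately show ?thesis unfolding G_def by simp
  qed
  let ?I = "\<lambda>n. \<integral>t. fourier f t * cis (x * t) * complex_of_real (G n t) \<partial>lborel"
  have lim1: "?I \<longlonglongrightarrow> (\<integral>t. fourier f t * cis (x * t) \<partial>lborel)"
  proof (rule integral_dominated_convergence[where w="\<lambda>t. norm (fourier f t)"])
    show "AE t in lborel. (\<lambda>n. fourier f t * cis (x * t) * complex_of_real (G n t)) \<longlonglongrightarrow> fourier f t * cis (x * t)"
    proof (rule AE_I2)
      fix t
      have "(\<lambda>n. fourier f t * cis (x * t) * complex_of_real (G n t)) \<longlonglongrightarrow> fourier f t * cis (x * t) * complex_of_real 1"
        by (intro tendsto_intros Glim)
      then show "(\<lambda>n. fourier f t * cis (x * t) * complex_of_real (G n t)) \<longlonglongrightarrow> fourier f t * cis (x * t)" by simp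
    qed
    show "AE t in lborel. norm (fourier f t * cis (x * t) * complex_of_real (G n t)) \<le> norm (fourier f t)" for n
      using G1 by (intro AE_I2) (simp add: norm_mult mult_left_le)
  qed (use iF in \<open>auto intro!: integrable_norm\<close>)
  have I: "?I n = (\<integral>z. complex_of_real (sqrt (2 * pi) * (f (x + inverse (real (Suc n)) * z) * exp (- z\<^sup>2 / 2))) \<partial>lborel)" for n
  proof -
    have n0: "real (Suc n) > 0" by simp
    let ?H = "\<lambda>(t, y). complex_of_real (f y * G n t) * cis (x * t - t * y)"
    \<comment> \<open>The cutoff makes the double integrand absolutely integrable on the plane,
      which permits exchanging the order of integration.\<close>
    have iH: "integrable (lborel \<Otimes>\<^sub>M lborel) ?H"
    proof (rule lborel_pair.Fubini_integrable)
      have "(\<lambda>t. \<integral>y. norm (?H (t, y)) \<partial>lborel) = (\<lambda>t. (\<integral>y. \<bar>f y\<bar> \<partial>lborel) * G n t)"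
        using G1 by (auto simp: norm_mult abs_mult)
      then show "integrable lborel (\<lambda>t. \<integral>y. norm (?H (t, y)) \<partial>lborel)"
        using gaussian_integrable[OF n0] by (simp add: G_def)
      show "AE t in lborel. integrable lborel (\<lambda>y. ?H (t, y))"
        using i by (auto intro!: integrable_mult_cis)
    qed measurable
    have "?I n = (\<integral>t. (\<integral>y. ?H (t, y) \<partial>lborel) \<partial>lborel)"
    proof (rule Bochner_Integration.integral_cong[OF refl])
      fix t
      have "(\<integral>y. ?H (t, y) \<partial>lborel) = (\<integral>y. complex_of_real (f y) * cis (- (t \<bullet> y)) * (cis (x * t) * complex_of_real (G n t)) \<partial>lborel)"
        by (intro Bochner_Integration.integral_cong) (auto simp: cis_mult[symmetric] diff_conv_add_uminus simp del: add_uminus_conv_diff)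
      also have "\<dots> = fourier f t * (cis (x * t) * complex_of_real (G n t))"
        unfolding fourier_def by (rule integral_mult_left_zero)
      finally show "fourier f t * cis (x * t) * complex_of_real (G n t) = (\<integral>y. ?H (t, y) \<partial>lborel)" by (simp add: mult.assoc)
    qed
    also have "\<dots> = (\<integral>y. (\<integral>t. ?H (t, y) \<partial>lborel) \<partial>lborel)"
      using lborel_pair.Fubini_integral[of "\<lambda>t y. ?H (t, y)"] iH by simp
    also have "\<dots> = (\<integral>y. complex_of_real (f y * (real (Suc n) * sqrt (2 * pi) * exp (- ((x - y) * real (Suc n))\<^sup>2 / 2))) \<partial>lborel)"
    proof (rule Bochner_Integration.integral_cong[OF refl])
      fix y
      have "(\<integral>t. ?H (t, y) \<partial>lborel) = (\<integral>t. complex_of_real (f y) * (cis ((x - y) * t) * complex_of_real (exp (- (t / real (Suc n))\<^sup>2 / 2))) \<partial>lborel)"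
        by (intro Bochner_Integration.integral_cong) (auto simp: G_def algebra_simps)
      also have "\<dots> = complex_of_real (f y) * complex_of_real (real (Suc n) * sqrt (2 * pi) * exp (- ((x - y) * real (Suc n))\<^sup>2 / 2))"
        by (subst integral_mult_right_zero, subst gaussian_cis_integral[OF n0]) simp
      finally show "(\<integral>t. ?H (t, y) \<partial>lborel) = complex_of_real (f y * (real (Suc n) * sqrt (2 * pi) * exp (- ((x - y) * real (Suc n))\<^sup>2 / 2)))"
        by simp
    qed
    \<comment> \<open>The substitution \<open>y = x + z / Suc n\<close> freezes the Gaussian and
      moves the dependence on n into the argument of f.\<close>
    also have "\<dots> = \<bar>inverse (real (Suc n))\<bar> *\<^sub>R (\<integral>z. complex_of_real (f (x + inverse (real (Suc n)) * z) * (real (Suc n) * sqrt (2 * pi) * exp (- ((x - (x + inverse (real (Suc n)) * z)) * real (Suc n))\<^sup>2 / 2))) \<partial>lborel)"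
      by (rule lborel_integral_real_affine) simp
    also have "\<dots> = (\<integral>z. \<bar>inverse (real (Suc n))\<bar> *\<^sub>R complex_of_real (f (x + inverse (real (Suc n)) * z) * (real (Suc n) * sqrt (2 * pi) * exp (- ((x - (x + inverse (real (Suc n)) * z)) * real (Suc n))\<^sup>2 / 2))) \<partial>lborel)"
      by simp
    also have "\<dots> = (\<integral>z. complex_of_real (sqrt (2 * pi) * (f (x + inverse (real (Suc n)) * z) * exp (- z\<^sup>2 / 2))) \<partial>lborel)"
    proof (rule Bochner_Integration.integral_cong[OF refl])
      fix z
      have "(x - (x + inverse (real (Suc n)) * z)) * real (Suc n) = - z" by (simp add: field_simps del: of_nat_Suc)
      moreover have "\<bar>inverse m\<bar> *\<^sub>R complex_of_real (A * (m * q * E)) = complex_of_real (q * (A * E))"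
        if "m > 0" for m A q E :: real
      proof -
        have "\<bar>inverse m\<bar> * (A * (m * q * E)) = q * (A * E)" using that by simp
        then show ?thesis by (simp only: scaleR_conv_of_real of_real_mult[symmetric])
      qed
      ultimately show "\<bar>inverse (real (Suc n))\<bar> *\<^sub>R complex_of_real (f (x + inverse (real (Suc n)) * z) * (real (Suc n) * sqrt (2 * pi) * exp (- ((x - (x + inverse (real (Suc n)) * z)) * real (Suc n))\<^sup>2 / 2)))
         = complex_of_real (sqrt (2 * pi) * (f (x + inverse (real (Suc n)) * z) * exp (- z\<^sup>2 / 2)))"
        by (simp only: n0 power2_minus)
    qed
    finally show ?thesis .
  qed
  have lim2: "?I \<longlonglongrightarrow> (\<integral>z. complex_of_real (sqrt (2 * pi) * (f x * exp (- z\<^sup>2 / 2))) \<partial>lborel)"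
    unfolding I
  proof (rule integral_dominated_convergence[where w="\<lambda>z. sqrt (2 * pi) * (B * exp (- z\<^sup>2 / 2))"])
    show "integrable lborel (\<lambda>z. sqrt (2 * pi) * (B * exp (- z\<^sup>2 / 2)))"
      using gaussian_integrable[of 1] by (intro integrable_mult_right) simp
    show "AE z in lborel. (\<lambda>n. complex_of_real (sqrt (2 * pi) * (f (x + inverse (real (Suc n)) * z) * exp (- z\<^sup>2 / 2))))
         \<longlonglongrightarrow> complex_of_real (sqrt (2 * pi) * (f x * exp (- z\<^sup>2 / 2)))"
    proof (rule AE_I2)
      fix z
      have "(\<lambda>n. x + inverse (real (Suc n)) * z) \<longlonglongrightarrow> x + 0 * z"
        by (intro tendsto_intros LIMSEQ_inverse_real_of_nat)
      then have "(\<lambda>n. f (x + inverse (real (Suc n)) * z)) \<longlonglongrightarrow> f x"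
        using c by (intro continuous_on_tendsto_compose[OF c]) auto
      then show "(\<lambda>n. complex_of_real (sqrt (2 * pi) * (f (x + inverse (real (Suc n)) * z) * exp (- z\<^sup>2 / 2))))
         \<longlonglongrightarrow> complex_of_real (sqrt (2 * pi) * (f x * exp (- z\<^sup>2 / 2)))"
        by (intro tendsto_intros)
    qed
    show "AE z in lborel. norm (complex_of_real (sqrt (2 * pi) * (f (x + inverse (real (Suc n)) * z) * exp (- z\<^sup>2 / 2))))
       \<le> sqrt (2 * pi) * (B * exp (- z\<^sup>2 / 2))" for n
      using B by (intro AE_I2) (simp add: norm_mult abs_mult)
  qed measurable
  \<comment> \<open>The Gaussian formula at frequency 0 supplies the remaining factor
    \<open>sqrt (2 * pi)\<close>.\<close>
  have "(\<integral>z. complex_of_real (sqrt (2 * pi) * (f x * exp (- z\<^sup>2 / 2))) \<partial>lborel)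
      = complex_of_real (sqrt (2 * pi) * f x) * (\<integral>t. cis (0 * t) * complex_of_real (exp (- (t / 1)\<^sup>2 / 2)) \<partial>lborel)"
    by (subst integral_mult_right_zero[symmetric]) (simp add: mult.assoc)
  also have "\<dots> = complex_of_real (2 * pi * f x)"
    by (subst gaussian_cis_integral) (auto simp: algebra_simps simp flip: of_real_mult)
  finally have e: "(\<integral>z. complex_of_real (sqrt (2 * pi) * (f x * exp (- z\<^sup>2 / 2))) \<partial>lborel) = complex_of_real (2 * pi * f x)" .
  from LIMSEQ_unique[OF lim1 lim2] show ?thesis unfolding e .
qed

section \<open>Bump functions and their Fourier transforms\<close>

text \<open>The polynomial parameter makes the family stable under differentiation: with y = 1/x,
  the x-derivative of \<open>P(y) exp(-y)\<close> is \<open>y^2 (P - P')(y) exp(-y)\<close>. The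
  case P = 1 is the classical flat function.\<close>

definition exp_bump :: "real poly \<Rightarrow> real \<Rightarrow> real" where
  "exp_bump P x = (if x > 0 then poly P (inverse x) * exp (- inverse x) else 0)"

lemma poly_exp_minus_tendsto_0: "((\<lambda>y. poly P y * exp (- y)) \<longlongrightarrow> (0::real)) at_top"
proof -
  have "((\<lambda>y. \<Sum>i\<le>degree P. coeff P i * (y ^ i / exp y)) \<longlongrightarrow> (\<Sum>i\<le>degree P. coeff P i * 0)) at_top"
    by (intro tendsto_intros tendsto_power_div_exp_0)
  moreover have "(\<Sum>i\<le>degree P. coeff P i * (y ^ i / exp y)) = poly P y * exp (- y)" for y
    by (simp add: poly_altdef sum_distrib_right exp_minus divide_inverse mult.assoc)
  ultimately show ?thesis by simp
qed

lemma exp_bump_deriv: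
  "(exp_bump P has_real_derivative exp_bump (monom 1 2 * (P - pderiv P)) x) (at x)"
proof (cases x "0::real" rule: linorder_cases)
  case greater
  have "((\<lambda>x. poly P (inverse x) * exp (- inverse x)) has_real_derivative
      exp_bump (monom 1 2 * (P - pderiv P)) x) (at x)"
    using greater
    by (auto intro!: derivative_eq_intros DERIV_chain2[OF poly_DERIV]
        simp: exp_bump_def poly_monom power2_eq_square algebra_simps)
  moreover have "open ({0<..} :: real set)" by simp
  ultimately show ?thesis
    by (rule has_field_derivative_transform_within_open[where S="{0<..}"])
       (use greater in \<open>auto simp: exp_bump_def\<close>)
next
  case less
  have "((\<lambda>_. 0) has_real_derivative 0) (at x)" by simp
  moreover have "open ({..<0} :: real set)" by simp
  ultimately have "(exp_bump P has_real_derivative 0) (at x)"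
    by (rule has_field_derivative_transform_within_open)
       (use less in \<open>auto simp: exp_bump_def\<close>)
  then show ?thesis using less by (simp add: exp_bump_def)
next
  case equal
  have "((\<lambda>y. exp_bump P y / y) \<longlongrightarrow> 0) (at_right 0)"
  proof -
    \<comment> \<open>\<open>pCons 0 P\<close> is P times its variable and absorbs the factor
      \<open>1 / y\<close> of the difference quotient at 0.\<close>
    have "((\<lambda>y. poly (pCons 0 P) (inverse y) * exp (- inverse y)) \<longlongrightarrow> 0) (at_right 0)"
      using filterlim_compose[OF poly_exp_minus_tendsto_0 filterlim_inverse_at_top_right] .
    then show ?thesis
      by (rule Lim_transform_eventually)
         (auto simp: eventually_at_filter exp_bump_def divide_inverse mult_ac)
  qed
  moreover have "((\<lambda>y. exp_bump P y / y) \<longlongrightarrow> 0) (at_left 0)"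
    by (rule tendsto_eventually) (auto simp: eventually_at_filter exp_bump_def)
  ultimately have "((\<lambda>y. exp_bump P y / y) \<longlongrightarrow> 0) (at 0)"
    by (simp add: filterlim_at_split)
  then show ?thesis using equal
    by (simp add: has_field_derivative_iff exp_bump_def)
qed

lemma smooth1_exp_bump: "smooth1 (exp_bump P)"
  by (rule smooth1_coinduct[where P="\<lambda>h. \<exists>P. h = exp_bump P"]) (use exp_bump_deriv in blast)+

lemma bump_exists:
  obtains a :: "real \<Rightarrow> real" where "smooth1 a" "\<And>x. a x \<ge> 0" "a 0 > 0" "\<And>x. a (- x) = a x"
    "\<And>x. \<bar>x\<bar> > 1/2 \<Longrightarrow> a x = 0"
proof
  \<comment> \<open>The flat function times its mirror image, each moved by 1/2: even and supported
    in the interval from -1/2 to 1/2. The radius 1/2 is small enough that a spectrum centred at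
    distance at least 1 stays away from the origin.\<close>
  let ?a = "\<lambda>x. exp_bump 1 (1 * x + 1/2) * exp_bump 1 ((-1) * x + 1/2)"
  show "smooth1 ?a" by (intro smooth1_mult smooth1_compose_affine smooth1_exp_bump)
qed (auto simp: exp_bump_def)

section \<open>Cosine and sine transforms of test functions\<close>

text \<open>The sine part is carried along because differentiating in x and multiplying by x both
  exchange cosine and sine: the pair is stable under the two operations, the cosine transform alone
  is not.\<close>

definition trig_transform :: "(real \<Rightarrow> real) \<Rightarrow> (real \<Rightarrow> real) \<Rightarrow> real \<Rightarrow> real" where
  "trig_transform b c x = (\<integral>t. b t * cos (x * t) + c t * sin (x * t) \<partial>lborel)"

lemma test1_neg: "test1 f \<Longrightarrow> test1 (\<lambda>x. - f x)"
  using test1_mult[OF smooth1_const[of "-1"], of f] by simp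

lemma test1_zero [simp]: "test1 (\<lambda>_. 0)" by (simp add: test1_def)

lemma test1_common_support:
  assumes "test1 b" "test1 c"
  obtains R where "\<And>x. \<bar>x\<bar> > R \<Longrightarrow> b x = 0" "\<And>x. \<bar>x\<bar> > R \<Longrightarrow> c x = 0"
proof -
  obtain R S where "\<And>x. \<bar>x\<bar> > R \<Longrightarrow> b x = 0" "\<And>x. \<bar>x\<bar> > S \<Longrightarrow> c x = 0"
    using assms by (auto simp: test1_def)
  then show ?thesis by (intro that[of "max R S"]) auto
qed

lemma trig_transform_deriv:
  assumes "test1 b" "test1 c"
  shows "(trig_transform b c has_real_derivative trig_transform (\<lambda>t. t * c t) (\<lambda>t. - (t * b t)) x) (at x)"
proof -
  obtain R where R: "\<And>x. \<bar>x\<bar> > R \<Longrightarrow> b x = 0" "\<And>x. \<bar>x\<bar> > R \<Longrightarrow> c x = 0"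
    using test1_common_support[OF assms] by metis
  note sc = assms[THEN test1_smooth1, THEN smooth1_continuous]
  have sc1: "continuous_on UNIV (\<lambda>p::real\<times>real. b (snd p))" "continuous_on UNIV (\<lambda>p::real\<times>real. c (snd p))"
    by (intro continuous_on_compose2[OF sc(1)[of UNIV]] continuous_on_compose2[OF sc(2)[of UNIV]] continuous_intros; simp)+
  show ?thesis
    unfolding trig_transform_def
    by (rule has_derivative_under_lborel[where R=R])
       (auto intro!: derivative_eq_intros continuous_intros sc sc1 simp: R split_beta algebra_simps)
qed

text \<open>Integration by parts in t: the difference of the two integrands is the t-derivative of
  the compactly supported function \<open>b t * sin (x * t) - c t * cos (x * t)\<close>.\<close>

lemma trig_transform_times:
  assumes "test1 b" "test1 c" "test1 b'" "test1 c'"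
    and d: "\<And>x. (b has_real_derivative b' x) (at x)" "\<And>x. (c has_real_derivative c' x) (at x)"
  shows "x * trig_transform b c x = trig_transform c' (\<lambda>t. - b' t) x"
proof -
  note sc = assms(1-4)[THEN test1_smooth1, THEN smooth1_continuous]
  obtain R where R: "\<And>x. \<bar>x\<bar> > R \<Longrightarrow> b x = 0" "\<And>x. \<bar>x\<bar> > R \<Longrightarrow> c x = 0"
    using test1_common_support[OF assms(1,2)] by metis
  obtain R' where R': "\<And>x. \<bar>x\<bar> > R' \<Longrightarrow> b' x = 0" "\<And>x. \<bar>x\<bar> > R' \<Longrightarrow> c' x = 0"
    using test1_common_support[OF assms(3,4)] by metis
  have "(\<integral>t. (x * (b t * cos (x * t) + c t * sin (x * t)) - (c' t * cos (x * t) + (- b' t) * sin (x * t))) \<partial>lborel) = 0"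
    by (rule lborel_integral_deriv_compact_support[where F="\<lambda>t. b t * sin (x * t) - c t * cos (x * t)" and R=R])
       (auto intro!: derivative_eq_intros continuous_intros sc d simp: R algebra_simps)
  moreover have "integrable lborel (\<lambda>t. x * (b t * cos (x * t) + c t * sin (x * t)))"
    by (rule lborel_integral_compact_support[where R=R]) (auto simp: R intro!: continuous_intros sc)
  moreover have "integrable lborel (\<lambda>t. c' t * cos (x * t) + (- b' t) * sin (x * t))"
    by (rule lborel_integral_compact_support[where R=R']) (auto simp: R' intro!: continuous_intros sc)
  ultimately show ?thesis
    unfolding trig_transform_def by (subst (asm) Bochner_Integration.integral_diff) auto
qed

lemma trig_transform_bounded:
  assumes "test1 b" "test1 c" shows "\<exists>B. \<forall>x. \<bar>trig_transform b c x\<bar> \<le> B"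
proof -
  have i: "integrable lborel b" "integrable lborel c"
    by (intro rapid_integrable test1_rapid smooth1_continuous test1_smooth1 assms)+
  have "\<bar>trig_transform b c x\<bar> \<le> (\<integral>t. \<bar>b t\<bar> + \<bar>c t\<bar> \<partial>lborel)" for x
    unfolding trig_transform_def
  proof (rule order_trans[OF integral_abs_bound integral_mono'])
    show "integrable lborel (\<lambda>t. \<bar>b t\<bar> + \<bar>c t\<bar>)" using i by auto
    fix t
    have "\<bar>b t * cos (x * t)\<bar> \<le> \<bar>b t\<bar>" "\<bar>c t * sin (x * t)\<bar> \<le> \<bar>c t\<bar>"
      by (auto simp: abs_mult mult_left_le)
    then show "\<bar>b t * cos (x * t) + c t * sin (x * t)\<bar> \<le> \<bar>b t\<bar> + \<bar>c t\<bar>" by linarith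
  qed auto
  then show ?thesis by blast
qed

text \<open>Each power of |x| costs one derivative of the coefficients, which remain test functions;
  hence the induction generalises over b and c.\<close>

lemma rapid_trig_transform:
  assumes "test1 b" "test1 c" shows "rapid (trig_transform b c)"
proof -
  have "\<exists>B. \<forall>x. (1 + \<bar>x\<bar>) ^ m * \<bar>trig_transform b c x\<bar> \<le> B" for m
    using assms
  proof (induction m arbitrary: b c)
    case 0 then show ?case using trig_transform_bounded by simp
  next
    case (Suc m)
    obtain b' where b': "test1 b'" "\<And>x. (b has_real_derivative b' x) (at x)"
      using test1E[OF Suc.prems(1)] by metis
    obtain c' where c': "test1 c'" "\<And>x. (c has_real_derivative c' x) (at x)"
      using test1E[OF Suc.prems(2)] by metis
    obtain A where A: "\<And>x. (1 + \<bar>x\<bar>) ^ m * \<bar>trig_transform b c x\<bar> \<le> A"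
      using Suc by meson
    obtain B where B: "\<And>x. (1 + \<bar>x\<bar>) ^ m * \<bar>trig_transform c' (\<lambda>t. - b' t) x\<bar> \<le> B"
      using Suc.IH[OF c'(1) test1_neg[OF b'(1)]] by meson
    have "(1 + \<bar>x\<bar>) ^ Suc m * \<bar>trig_transform b c x\<bar> \<le> A + B" for x
    proof -
      have "(1 + \<bar>x\<bar>) ^ Suc m * \<bar>trig_transform b c x\<bar>
          = (1 + \<bar>x\<bar>) ^ m * \<bar>trig_transform b c x\<bar> + (1 + \<bar>x\<bar>) ^ m * \<bar>x * trig_transform b c x\<bar>"
        by (simp add: abs_mult algebra_simps)
      also have "\<dots> \<le> A + B"
        unfolding trig_transform_times[OF Suc.prems b'(1) c'(1) b'(2) c'(2)]
        by (intro add_mono A B)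
      finally show ?thesis .
    qed
    then show ?case by blast
  qed
  then show ?thesis by (simp add: rapid_def)
qed

lemma test1_times_id: "test1 f \<Longrightarrow> test1 (\<lambda>t. t * f t)"
  using test1_mult[OF smooth1_affine[of 1 0], of f] by simp

lemma schwartz1_trig_transform:
  assumes "test1 b" "test1 c" shows "schwartz1 (trig_transform b c)"
proof (rule schwartz1_coinduct[where P="\<lambda>h. \<exists>b c. test1 b \<and> test1 c \<and> h = trig_transform b c"], goal_cases)
  case 1 then show ?case using assms by blast
next
  case (2 h)
  then obtain b c where h: "test1 b" "test1 c" "h = trig_transform b c" by blast
  show ?case unfolding h(3)
    using trig_transform_deriv[OF h(1,2)] test1_times_id[OF h(2)] test1_neg[OF test1_times_id[OF h(1)]] by blast
next
  case (3 h) then show ?case using rapid_trig_transform by blast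
qed

lemma integral_odd_zero:
  fixes f :: "real \<Rightarrow> real" assumes "\<And>x. f (- x) = - f x" shows "(\<integral>x. f x \<partial>lborel) = 0"
  using lborel_integral_real_affine[of "-1" f 0] assms by simp

lemma fourier_even:
  assumes i: "integrable lborel f" and e: "\<And>x. f (- x) = f x"
  shows "fourier f t = complex_of_real (\<integral>x. f x * cos (t * x) \<partial>lborel)"
proof -
  have [measurable]: "f \<in> borel_measurable borel" using i by auto
  have "integrable lborel (\<lambda>x. complex_of_real (f x) * cis (- (t \<bullet> x)))"
    by (rule integrable_mult_cis) (use i in auto)
  from integral_Re[OF this] integral_Im[OF this]
  have "Re (fourier f t) = (\<integral>x. f x * cos (t * x) \<partial>lborel)" "Im (fourier f t) = (\<integral>x. - (f x * sin (t * x)) \<partial>lborel)"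
    by (simp_all add: fourier_def)
  moreover have "(\<integral>x. - (f x * sin (t * x)) \<partial>lborel) = 0"
    by (rule integral_odd_zero) (simp add: e)
  ultimately show ?thesis by (simp add: complex_eq_iff)
qed

text \<open>Positivity of the Fourier transform \<open>v\<close> forces the strict maximum of \<open>u\<close> at the origin.\<close>
lemma cosine_transform_strict_max:
  fixes v :: "real \<Rightarrow> real"
  assumes c: "continuous_on UNIV v" and i: "integrable lborel v" and nn: "\<And>t. v t \<ge> 0" and p: "v 0 > 0"
    and u: "\<And>x. u x = k * (\<integral>t. v t * cos (x * t) \<partial>lborel)" and "k > 0" "x \<noteq> 0"
  shows "\<bar>u x\<bar> < u 0"
proof -
  have [measurable]: "v \<in> borel_measurable borel" using c by (rule borel_measurable_continuous_onI)
  have ic: "integrable lborel (\<lambda>t. v t * cos (x * t))"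
    by (rule Bochner_Integration.integrable_bound[OF i]) (auto simp: abs_mult mult_left_le)
  \<comment> \<open>The point 0 itself cannot witness strictness, since
    \<open>1 - cos (x * t)\<close> vanishes there. Moving slightly to the right keeps v positive
    while \<open>|x| * t\<close> lies strictly between 0 and pi, so that both \<open>1 - cos\<close>
    and \<open>1 + cos\<close> are positive.\<close>
  have "\<forall>\<^sub>F t in at_right 0. v t > 0"
    using c p by (intro order_tendstoD(1)[where y="v 0"])
       (auto simp: continuous_on_eq_continuous_at isCont_def intro: filterlim_at_split[THEN iffD1, THEN conjunct2])
  moreover have "\<forall>\<^sub>F t in at_right (0::real). t < pi / \<bar>x\<bar>"
    using assms(7) by (intro eventually_at_right_less eventually_at_rightI[of 0 "pi / \<bar>x\<bar>"]) auto
  moreover have "\<forall>\<^sub>F t in at_right (0::real). t > 0" by (rule eventually_at_right_less)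
  ultimately have "\<forall>\<^sub>F t in at_right 0. v t > 0 \<and> t < pi / \<bar>x\<bar> \<and> t > 0" by eventually_elim auto
  then obtain t0 where t0: "v t0 > 0" "t0 < pi / \<bar>x\<bar>" "t0 > 0"
    using eventually_happens'[OF trivial_limit_at_right_real] by blast
  have s: "sin (\<bar>x\<bar> * t0) > 0"
    using t0 assms(7) by (intro sin_gt_zero) (auto simp: field_simps)
  have "cos (\<bar>x\<bar> * t0) \<noteq> 1" "cos (\<bar>x\<bar> * t0) \<noteq> -1"
    using sin_cos_squared_add[of "\<bar>x\<bar> * t0"] s by (auto simp: power2_eq_square)
  moreover have "cos (x * t0) = cos (\<bar>x\<bar> * t0)" by (auto simp: abs_if)
  ultimately have ct: "cos (x * t0) < 1" "cos (x * t0) > -1"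
    using cos_le_one[of "x * t0"] cos_ge_minus_one[of "x * t0"] by (auto simp: less_le)
  have vc: "v t * cos (x * t) \<le> v t" "0 \<le> v t + v t * cos (x * t)" for t
    using mult_left_mono[OF cos_le_one[of "x * t"] nn[of t]] mult_left_mono[OF cos_ge_minus_one[of "x * t"] nn[of t]]
    by simp_all
  have p2: "0 < v t0 + v t0 * cos (x * t0)"
    using mult_pos_pos[of "v t0" "1 + cos (x * t0)"] t0 ct by (simp add: distrib_left)
  have "0 < (\<integral>t. v t * (1 - cos (x * t)) \<partial>lborel)"
    by (rule integral_continuous_pos[where ?x0.0=t0])
       (use i ic t0 ct in \<open>auto intro!: continuous_intros c nn simp: right_diff_distrib vc\<close>)
  moreover have "0 < (\<integral>t. v t * (1 + cos (x * t)) \<partial>lborel)"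
    by (rule integral_continuous_pos[where ?x0.0=t0])
       (use i ic t0 ct cos_ge_minus_one in \<open>auto intro!: continuous_intros c nn simp: distrib_left vc p2\<close>)
  ultimately have "\<bar>\<integral>t. v t * cos (x * t) \<partial>lborel\<bar> < (\<integral>t. v t \<partial>lborel)"
    using i ic by (simp add: distrib_left right_diff_distrib)
  then show ?thesis using \<open>k > 0\<close> by (simp add: u abs_mult)
qed

section \<open>The two envelopes\<close>

text \<open>A common interface for both envelopes, u being the envelope on the line and v its
  transform, so that everything up to the negative integral is proved once.\<close>

definition profile :: "(real \<Rightarrow> real) \<Rightarrow> (real \<Rightarrow> real) \<Rightarrow> bool" where
  "profile u v \<longleftrightarrow> schwartz1 u \<and> (\<forall>t. fourier u t = complex_of_real (v t)) \<and> continuous_on UNIV v \<and>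
     rapid v \<and> (\<forall>t. v t \<ge> 0) \<and> v 0 > 0 \<and> (\<forall>x. x \<noteq> 0 \<longrightarrow> \<bar>u x\<bar> < u 0)"

lemma fourier_test1_even:
  assumes "test1 a" "\<And>x. a (- x) = a x"
  shows "fourier a t = complex_of_real (trig_transform a (\<lambda>_. 0) t)"
proof -
  have "integrable lborel a"
    by (intro rapid_integrable test1_rapid smooth1_continuous test1_smooth1 assms)
  then show ?thesis using fourier_even[of a t] assms(2) by (simp add: trig_transform_def)
qed

text \<open>Let u be the transform of an even bump. Inversion returns \<open>2 * pi\<close> times
  the bump as the transform of u, so the sign and the support of the spectrum are those of the
  bump.\<close>

lemma band_limited_profile:
  obtains u v where "profile u v" "\<And>t. \<bar>t\<bar> > 1/2 \<Longrightarrow> v t = 0"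
proof -
  obtain a :: "real \<Rightarrow> real" where a: "smooth1 a" "\<And>x. a x \<ge> 0" "a 0 > 0" "\<And>x. a (- x) = a x"
    "\<And>x. \<bar>x\<bar> > 1/2 \<Longrightarrow> a x = 0" using bump_exists by metis
  have ta: "test1 a" using a(1,5) unfolding test1_def by blast
  define u where "u = trig_transform a (\<lambda>_. 0)"
  have F: "fourier a = (\<lambda>t. complex_of_real (u t))"
    unfolding u_def by (rule ext) (rule fourier_test1_even[OF ta a(4)])
  have su: "schwartz1 u" unfolding u_def by (intro schwartz1_trig_transform ta) simp
  have ia: "integrable lborel a" by (intro rapid_integrable test1_rapid smooth1_continuous ta a)
  have iu: "integrable lborel u"
    by (intro rapid_integrable schwartz1_rapid smooth1_continuous schwartz1_smooth1 su)
  obtain B where B: "\<And>x. \<bar>a x\<bar> \<le> B" using rapid_bounded[OF test1_rapid[OF ta]] by metis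
  have inv: "(\<integral>s. fourier a s * cis (x * s) \<partial>lborel) = complex_of_real (2 * pi * a x)" for x
    by (rule fourier_inversion[OF smooth1_continuous[OF a(1)] B ia]) (use iu in \<open>simp add: F\<close>)
  define v where "v = (\<lambda>t. 2 * pi * a t)"
  \<comment> \<open>Evaluated at \<open>-t\<close>, the inversion formula has the kernel of
    \<open>fourier u t\<close>; evenness removes the sign on the other side.\<close>
  have "fourier u t = complex_of_real (v t)" for t
    using inv[of "-t"] unfolding F fourier_def v_def by (simp add: a(4))
  moreover have cv: "continuous_on UNIV v" unfolding v_def by (intro continuous_intros smooth1_continuous a)
  moreover have rv: "rapid v" unfolding v_def by (intro rapid_cmult test1_rapid ta)
  moreover have "\<bar>u x\<bar> < u 0" if "x \<noteq> 0" for x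
  proof (rule cosine_transform_strict_max[where v=v and k="1 / (2 * pi)"])
    show "u x = 1 / (2 * pi) * (\<integral>t. v t * cos (x * t) \<partial>lborel)" for x
      unfolding v_def u_def trig_transform_def by (simp add: mult.assoc)
    show "v t \<ge> 0" "v 0 > 0" for t using a by (auto simp: v_def)
  qed (use that in \<open>auto intro: cv rapid_integrable rv\<close>)
  ultimately have "profile u v" using su a by (auto simp: profile_def v_def)
  then show ?thesis by (rule that) (simp add: v_def a)
qed

definition convol :: "(real \<Rightarrow> real) \<Rightarrow> (real \<Rightarrow> real) \<Rightarrow> real \<Rightarrow> real" where
  "convol a c x = (\<integral>t. a t * c (x - t) \<partial>lborel)"

lemma test1_convol:
  assumes a: "test1 a" and c: "test1 c" shows "test1 (convol a c)"
proof -
  obtain R where R: "\<And>x. \<bar>x\<bar> > R \<Longrightarrow> a x = 0" using a by (auto simp: test1_def)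
  note sa = smooth1_continuous[OF test1_smooth1[OF a]]
  have "smooth1 (convol a c)"
  \<comment> \<open>Every derivative is moved onto the second factor. The class keeps the compactly
    supported a fixed and asks only smoothness of c, as a alone bounds the range of
    integration.\<close>
  proof (rule smooth1_coinduct[where P="\<lambda>h. \<exists>c. smooth1 c \<and> h = convol a c"], goal_cases)
    case 1 show ?case using c test1_smooth1 by blast
  next
    case (2 h)
    then obtain c where c: "smooth1 c" "h = convol a c" by blast
    obtain c' where c': "smooth1 c'" "\<And>x. (c has_real_derivative c' x) (at x)"
      using smooth1E[OF c(1)] by metis
    note sc = smooth1_continuous[OF c(1)] smooth1_continuous[OF c'(1)]
    have "(h has_real_derivative convol a c' x) (at x)" for x
      unfolding c(2) convol_def
    proof (rule has_derivative_under_lborel[where R=R])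
      show "((\<lambda>x. a t * c (x - t)) has_real_derivative a t * c' (x - t)) (at x)" for x t
      proof -
        have "((\<lambda>x. c (x - t)) has_real_derivative c' (x - t) * 1) (at x)"
          by (rule DERIV_chain2[OF c'(2)]) (auto intro!: derivative_eq_intros)
        from DERIV_cmult[OF this, of "a t"] show ?thesis by simp
      qed
      show "continuous_on UNIV (\<lambda>(x, t). a t * c' (x - t))"
        unfolding split_beta
        by (intro continuous_intros continuous_on_compose2[OF sa[of UNIV]] continuous_on_compose2[OF sc(2)[of UNIV]]) auto
      show "continuous_on UNIV (\<lambda>t. a t * c (x - t))" for x
        by (intro continuous_intros sa continuous_on_compose2[OF sc(1)[of UNIV]]) auto
    qed (auto simp: R)
    then show ?case using c'(1) by blast
  qed
  moreover obtain S where S: "\<And>x. \<bar>x\<bar> > S \<Longrightarrow> c x = 0" using c by (auto simp: test1_def)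
  have "convol a c x = 0" if "\<bar>x\<bar> > R + S" for x
  proof -
    have "a t * c (x - t) = 0" for t
      using R[of t] S[of "x - t"] that by (cases "\<bar>t\<bar> > R") auto
    then have "(\<lambda>t. a t * c (x - t)) = (\<lambda>_. 0)" by (rule ext)
    then show ?thesis by (simp only: convol_def Bochner_Integration.integral_zero)
  qed
  ultimately show ?thesis by (auto simp: test1_def)
qed

lemma fourier_convol:
  assumes a: "test1 a" and c: "test1 c"
  shows "fourier (convol a c) s = fourier a s * fourier c s"
proof -
  note ta = test1_smooth1[OF a] test1_smooth1[OF c]
  note ca = ta[THEN smooth1_continuous]
  have ia: "integrable lborel a" "integrable lborel c" by (intro rapid_integrable test1_rapid ca a c)+
  have [measurable]: "a \<in> borel_measurable borel" "c \<in> borel_measurable borel"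
    using ca by (auto intro: borel_measurable_continuous_onI)
  have cm[measurable]: "cis \<in> borel_measurable borel"
    by (intro borel_measurable_continuous_onI continuous_intros)
  have sh: "integrable lborel (\<lambda>x. c (x - t))" "(\<integral>x. \<bar>c (x - t)\<bar> \<partial>lborel) = (\<integral>x. \<bar>c x\<bar> \<partial>lborel)" for t
    using lborel_integrable_real_affine[OF ia(2), of 1 "-t"] lborel_integral_real_affine[of 1 "\<lambda>x. \<bar>c x\<bar>" "-t"]
    by simp_all
  let ?H = "\<lambda>(t, x). complex_of_real (a t * c (x - t)) * cis (- (s * x))"
  have iH: "integrable (lborel \<Otimes>\<^sub>M lborel) ?H"
  proof (rule lborel_pair.Fubini_integrable)
    have "(\<lambda>t. \<integral>x. norm (?H (t, x)) \<partial>lborel) = (\<lambda>t. \<bar>a t\<bar> * (\<integral>x. \<bar>c x\<bar> \<partial>lborel))"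
      by (auto simp: norm_mult abs_mult sh)
    then show "integrable lborel (\<lambda>t. \<integral>x. norm (?H (t, x)) \<partial>lborel)" using ia by simp
    have "integrable lborel (\<lambda>x. complex_of_real (a t * c (x - t)))" for t
      using sh(1)[of t] by (simp del: of_real_mult)
    then show "AE t in lborel. integrable lborel (\<lambda>x. ?H (t, x))"
      by (auto intro!: integrable_mult_cis simp del: of_real_mult)
  qed measurable
  have "fourier (convol a c) s = (\<integral>x. (\<integral>t. ?H (t, x) \<partial>lborel) \<partial>lborel)"
    unfolding fourier_def
  proof (rule Bochner_Integration.integral_cong[OF refl])
    fix x
    have "complex_of_real (convol a c x) = (\<integral>t. complex_of_real (a t * c (x - t)) \<partial>lborel)"
      unfolding convol_def by (rule integral_complex_of_real[symmetric])
    then show "complex_of_real (convol a c x) * cis (- (s \<bullet> x)) = (\<integral>t. ?H (t, x) \<partial>lborel)"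
      by (simp only: prod.case inner_real_def integral_mult_left_zero)
  qed
  also have "\<dots> = (\<integral>t. (\<integral>x. ?H (t, x) \<partial>lborel) \<partial>lborel)"
    using lborel_pair.Fubini_integral[of "\<lambda>t x. ?H (t, x)"] iH by simp
  also have "\<dots> = (\<integral>t. complex_of_real (a t) * cis (- (s \<bullet> t)) * fourier c s \<partial>lborel)"
  proof (rule Bochner_Integration.integral_cong[OF refl])
    fix t
    have "(\<integral>x. ?H (t, x) \<partial>lborel) = (\<integral>x. ?H (t, t + 1 * x) \<partial>lborel)"
      using lborel_integral_real_affine[of 1 "\<lambda>x. ?H (t, x)" t] by simp
    also have "\<dots> = (\<integral>x. complex_of_real (a t) * cis (- (s \<bullet> t)) * (complex_of_real (c x) * cis (- (s \<bullet> x))) \<partial>lborel)"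
    proof (rule Bochner_Integration.integral_cong[OF refl])
      fix x
      have "cis (- (s * (t + 1 * x))) = cis (- (s \<bullet> t)) * cis (- (s \<bullet> x))"
        by (simp add: cis_mult algebra_simps)
      then show "?H (t, t + 1 * x) = complex_of_real (a t) * cis (- (s \<bullet> t)) * (complex_of_real (c x) * cis (- (s \<bullet> x)))"
        by simp
    qed
    also have "\<dots> = complex_of_real (a t) * cis (- (s \<bullet> t)) * fourier c s"
      unfolding fourier_def by (rule integral_mult_right_zero)
    finally show "(\<integral>x. ?H (t, x) \<partial>lborel) = complex_of_real (a t) * cis (- (s \<bullet> t)) * fourier c s" .
  qed
  also have "\<dots> = fourier a s * fourier c s"
    unfolding fourier_def by (rule integral_mult_left_zero)
  finally show ?thesis .
qed

text \<open>Evenness makes the transform w of the bump real, so the transform \<open>w * w\<close>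
  of the autoconvolution is nonnegative, and at 0 it is the square of a positive integral. Inversion
  then writes u as a cosine transform of this function, which yields the strict maximum.\<close>

lemma compactly_supported_profile:
  obtains u v where "profile u v" "test1 u"
proof -
  obtain a :: "real \<Rightarrow> real" where a: "smooth1 a" "\<And>x. a x \<ge> 0" "a 0 > 0" "\<And>x. a (- x) = a x"
    "\<And>x. \<bar>x\<bar> > 1/2 \<Longrightarrow> a x = 0" using bump_exists by metis
  have ta: "test1 a" using a(1,5) unfolding test1_def by blast
  define w where "w = trig_transform a (\<lambda>_. 0)"
  define v where "v = (\<lambda>t. w t * w t)"
  have F: "fourier a = (\<lambda>t. complex_of_real (w t))"
    unfolding w_def by (rule ext) (rule fourier_test1_even[OF ta a(4)])
  have sw: "schwartz1 w" unfolding w_def by (intro schwartz1_trig_transform ta) simp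
  define u where "u = convol a a"
  have tu: "test1 u" unfolding u_def by (intro test1_convol ta)
  have Fu: "fourier u = (\<lambda>t. complex_of_real (v t))"
    unfolding u_def v_def by (rule ext) (simp add: fourier_convol ta F)
  have cw: "continuous_on UNIV w" by (intro smooth1_continuous schwartz1_smooth1 sw)
  have cv: "continuous_on UNIV v" unfolding v_def by (intro continuous_intros cw)
  obtain B where B: "\<And>x. \<bar>w x\<bar> \<le> B" using rapid_bounded[OF schwartz1_rapid[OF sw]] by metis
  have rv: "rapid v" unfolding v_def by (intro rapid_mult_bounded[OF _ B] schwartz1_rapid sw)
  have iv: "integrable lborel v" by (intro rapid_integrable rv cv)
  have ia: "integrable lborel a" by (intro rapid_integrable test1_rapid smooth1_continuous ta a)
  have "w 0 = (\<integral>t. a t \<partial>lborel)" by (simp add: w_def trig_transform_def)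
  also have "\<dots> > 0" by (rule integral_continuous_pos[OF smooth1_continuous[OF a(1)] ia a(2,3)])
  finally have v0: "v 0 > 0" by (simp add: v_def)
  have cu: "continuous_on UNIV u" by (intro smooth1_continuous test1_smooth1 tu)
  have iu: "integrable lborel u" by (intro rapid_integrable test1_rapid tu cu)
  obtain C where C: "\<And>x. \<bar>u x\<bar> \<le> C" using rapid_bounded[OF test1_rapid[OF tu]] by metis
  have inv: "(\<integral>s. fourier u s * cis (x * s) \<partial>lborel) = complex_of_real (2 * pi * u x)" for x
    by (rule fourier_inversion[OF cu C iu]) (use iv in \<open>simp add: Fu\<close>)
  have ux: "u x = 1 / (2 * pi) * (\<integral>t. v t * cos (x * t) \<partial>lborel)" for x
  proof -
    have "integrable lborel (\<lambda>s. complex_of_real (v s) * cis (x * s))"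
      using iv by (intro integrable_mult_cis) auto
    from integral_Re[OF this] inv[of x] show ?thesis by (simp add: Fu)
  qed
  have "\<bar>u x\<bar> < u 0" if "x \<noteq> 0" for x
    by (rule cosine_transform_strict_max[where v=v and k="1 / (2 * pi)", OF cv iv _ v0 ux _ that])
       (simp_all add: v_def)
  then have "profile u v" using tu test1_schwartz1[OF tu] v0 cv rv by (auto simp: profile_def Fu v_def)
  then show ?thesis using tu by (rule that)
qed

section \<open>Products over coordinates\<close>

text \<open>Lebesgue measure is the image of a product of measures on lines under the coordinate
  map; this is the passage from the whole space to dimension one.\<close>

lemma lborel_integral_prod_Basis:
  fixes f :: "'a::euclidean_space \<Rightarrow> real \<Rightarrow> 'b::{real_normed_field, banach, second_countable_topology}"
  assumes i: "\<And>b. b \<in> Basis \<Longrightarrow> integrable lborel (f b)"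
  shows "integrable lborel (\<lambda>x. \<Prod>b\<in>Basis. f b (x \<bullet> b))"
    and "(\<integral>x. (\<Prod>b\<in>Basis. f b (x \<bullet> b)) \<partial>lborel) = (\<Prod>b\<in>Basis. \<integral>t. f b t \<partial>lborel)"
proof -
  interpret P: product_sigma_finite "\<lambda>_::'a. lborel :: real measure" by standard
  have [measurable]: "\<And>b. b \<in> Basis \<Longrightarrow> f b \<in> borel_measurable borel" using i by auto
  have m: "(\<lambda>x. \<Prod>b\<in>Basis. f b (x \<bullet> b)) \<in> borel_measurable borel" by measurable
  have T[measurable]: "(\<lambda>g. \<Sum>b\<in>Basis. g b *\<^sub>R b) \<in> (\<Pi>\<^sub>M b\<in>(Basis::'a set). lborel) \<rightarrow>\<^sub>M borel"
    by measurable
  have s: "(\<Prod>b\<in>Basis. f b ((\<Sum>c\<in>Basis. g c *\<^sub>R c) \<bullet> b)) = (\<Prod>b\<in>Basis. f b (g b))" for g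
    by (intro prod.cong refl) (simp add: inner_sum_left inner_Basis if_distrib sum.delta cong: if_cong)
  show "integrable lborel (\<lambda>x. \<Prod>b\<in>Basis. f b (x \<bullet> b))"
    unfolding lborel_eq[where 'a='a]
    by (subst integrable_distr_eq[OF T m]) (unfold s, rule P.product_integrable_prod[OF finite_Basis i])
  show "(\<integral>x. (\<Prod>b\<in>Basis. f b (x \<bullet> b)) \<partial>lborel) = (\<Prod>b\<in>Basis. \<integral>t. f b t \<partial>lborel)"
    unfolding lborel_eq[where 'a='a]
    by (subst integral_distr[OF T m]) (unfold s, rule P.product_integral_prod[OF finite_Basis i])
qed

lemma has_derivative_prod_Basis:
  fixes F F' :: "'a::euclidean_space \<Rightarrow> real \<Rightarrow> real"
  assumes "\<And>b t. b \<in> Basis \<Longrightarrow> (F b has_real_derivative F' b t) (at t)"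
  shows "((\<lambda>x. \<Prod>b\<in>Basis. F b (x \<bullet> b)) has_derivative
     (\<lambda>h. \<Sum>b\<in>Basis. (F' b (x \<bullet> b) * (h \<bullet> b)) * (\<Prod>c\<in>Basis - {b}. F c (x \<bullet> c)))) (at x)"
proof (rule has_derivative_prod)
  fix b :: 'a assume b: "b \<in> Basis"
  have "((\<lambda>x. x \<bullet> b) has_derivative (\<lambda>h. h \<bullet> b)) (at x)"
    by (intro derivative_eq_intros) auto
  from has_derivative_compose[OF this, of "F b" "(*) (F' b (x \<bullet> b))"] assms[OF b]
  show "((\<lambda>x. F b (x \<bullet> b)) has_derivative (\<lambda>h. F' b (x \<bullet> b) * (h \<bullet> b))) (at x)"
    by (simp add: has_field_derivative_def)
qed

text \<open>Differentiating along a basis vector hits only the factor in that coordinate, so a list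
  of directions acts through its multiplicities alone.\<close>

lemma iter_deriv_prod_Basis:
  fixes D :: "'a::euclidean_space \<Rightarrow> nat \<Rightarrow> real \<Rightarrow> real"
  assumes D: "\<And>b. b \<in> Basis \<Longrightarrow> deriv_seq (D b)" and "set vs \<subseteq> Basis"
  shows "iter_deriv vs (\<lambda>x. \<Prod>b\<in>Basis. D b 0 (x \<bullet> b)) = (\<lambda>x. \<Prod>b\<in>Basis. D b (count_list vs b) (x \<bullet> b))"
  using assms(2)
proof (induction vs)
  case (Cons v vs)
  then have v: "v \<in> Basis" by simp
  have d: "((\<lambda>x. \<Prod>b\<in>Basis. D b (count_list vs b) (x \<bullet> b)) has_derivative
     (\<lambda>h. \<Sum>b\<in>Basis. (D b (Suc (count_list vs b)) (x \<bullet> b) * (h \<bullet> b)) * (\<Prod>c\<in>Basis - {b}. D c (count_list vs c) (x \<bullet> c)))) (at x)" for x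
    by (rule has_derivative_prod_Basis) (use D in \<open>auto simp: deriv_seq_def\<close>)
  have "iter_deriv (v # vs) (\<lambda>x. \<Prod>b\<in>Basis. D b 0 (x \<bullet> b)) x = (\<Prod>b\<in>Basis. D b (count_list (v # vs) b) (x \<bullet> b))" for x
  proof -
    have "iter_deriv (v # vs) (\<lambda>x. \<Prod>b\<in>Basis. D b 0 (x \<bullet> b)) x
       = (\<Sum>b\<in>Basis. (D b (Suc (count_list vs b)) (x \<bullet> b) * (v \<bullet> b)) * (\<Prod>c\<in>Basis - {b}. D c (count_list vs c) (x \<bullet> c)))"
      using Cons.IH Cons.prems fun_cong[OF frechet_derivative_at[OF d[of x]], of v] by simp
    also have "\<dots> = (\<Sum>b\<in>Basis. if b = v then D b (Suc (count_list vs b)) (x \<bullet> b) * (\<Prod>c\<in>Basis - {b}. D c (count_list vs c) (x \<bullet> c)) else 0)"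
      using v by (intro sum.cong) (auto simp: inner_Basis)
    also have "\<dots> = D v (Suc (count_list vs v)) (x \<bullet> v) * (\<Prod>c\<in>Basis - {v}. D c (count_list vs c) (x \<bullet> c))"
      using v by (simp add: sum.delta)
    also have "\<dots> = D v (count_list (v # vs) v) (x \<bullet> v) * (\<Prod>c\<in>Basis - {v}. D c (count_list (v # vs) c) (x \<bullet> c))"
      by (intro arg_cong2[where f="(*)"] prod.cong) auto
    also have "\<dots> = (\<Prod>b\<in>Basis. D b (count_list (v # vs) b) (x \<bullet> b))"
      using v by (simp add: prod.remove[of Basis v])
    finally show ?thesis .
  qed
  then show ?case by (rule ext)
qed simp

lemma one_plus_sum_le_prod:
  fixes a :: "'b \<Rightarrow> real"
  assumes "finite A" "\<And>i. i \<in> A \<Longrightarrow> 0 \<le> a i"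
  shows "1 + sum a A \<le> (\<Prod>i\<in>A. 1 + a i)"
  using assms
proof (induction A rule: finite_induct)
  case (insert i A)
  have "1 + sum a (insert i A) \<le> (1 + a i) * (1 + sum a A)"
    using insert by (simp add: algebra_simps sum_nonneg)
  also have "\<dots> \<le> (1 + a i) * (\<Prod>i\<in>A. 1 + a i)" using insert by (intro mult_left_mono) auto
  finally show ?case using insert by simp
qed simp

text \<open>The norm is at most the sum of the absolute coordinates, and \<open>1 +\<close> that sum
  is part of the expansion of the product. Weights on the space thereby split into one factor per
  coordinate.\<close>

lemma one_plus_norm_le_prod:
  fixes x :: "'a::euclidean_space" shows "1 + norm x \<le> (\<Prod>b\<in>Basis. 1 + \<bar>x \<bullet> b\<bar>)"
proof -
  have "1 + norm x \<le> 1 + (\<Sum>b\<in>Basis. \<bar>x \<bullet> b\<bar>)" using norm_le_l1[of x] by simp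
  also have "\<dots> \<le> (\<Prod>b\<in>Basis. 1 + \<bar>x \<bullet> b\<bar>)" by (rule one_plus_sum_le_prod) auto
  finally show ?thesis .
qed

lemma rapid_prod_Basis:
  fixes F :: "'a::euclidean_space \<Rightarrow> real \<Rightarrow> real"
  assumes "\<And>b. b \<in> Basis \<Longrightarrow> rapid (F b)"
  obtains B where "\<And>x. (1 + norm x) ^ m * \<bar>\<Prod>b\<in>Basis. F b (x \<bullet> b)\<bar> \<le> B"
proof -
  from assms have "\<forall>b\<in>Basis. \<exists>B. \<forall>t. (1 + \<bar>t\<bar>) ^ m * \<bar>F b t\<bar> \<le> B" unfolding rapid_def by blast
  then obtain B where B: "\<And>b t. b \<in> Basis \<Longrightarrow> (1 + \<bar>t\<bar>) ^ m * \<bar>F b t\<bar> \<le> B b" by metis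
  show ?thesis
  proof
    fix x :: 'a
    have "(1 + norm x) ^ m * \<bar>\<Prod>b\<in>Basis. F b (x \<bullet> b)\<bar> \<le> (\<Prod>b\<in>Basis. 1 + \<bar>x \<bullet> b\<bar>) ^ m * \<bar>\<Prod>b\<in>Basis. F b (x \<bullet> b)\<bar>"
      by (intro mult_right_mono power_mono one_plus_norm_le_prod) auto
    also have "\<dots> = (\<Prod>b\<in>Basis. (1 + \<bar>x \<bullet> b\<bar>) ^ m * \<bar>F b (x \<bullet> b)\<bar>)"
      by (simp add: prod_power_distrib abs_prod prod.distrib)
    also have "\<dots> \<le> (\<Prod>b\<in>Basis. B b)" by (intro prod_mono) (auto intro: B)
    finally show "(1 + norm x) ^ m * \<bar>\<Prod>b\<in>Basis. F b (x \<bullet> b)\<bar> \<le> (\<Prod>b\<in>Basis. B b)" .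
  qed
qed

lemma schwartz_prod_Basis:
  fixes F :: "'a::euclidean_space \<Rightarrow> real \<Rightarrow> real"
  assumes "\<And>b. b \<in> Basis \<Longrightarrow> schwartz1 (F b)"
  shows "schwartz (\<lambda>x. \<Prod>b\<in>Basis. F b (x \<bullet> b))"
proof -
  have "\<forall>b\<in>Basis. \<exists>D. D 0 = F b \<and> deriv_seq D \<and> (\<forall>n. rapid (D n))"
    using assms unfolding schwartz1_def by blast
  then obtain D where D: "\<And>b. b \<in> Basis \<Longrightarrow> D b 0 = F b" "\<And>b. b \<in> Basis \<Longrightarrow> deriv_seq (D b)"
     "\<And>b n. b \<in> Basis \<Longrightarrow> rapid (D b n)" by metis
  have eq: "(\<lambda>x. \<Prod>b\<in>Basis. F b (x \<bullet> b)) = (\<lambda>x. \<Prod>b\<in>Basis. D b 0 (x \<bullet> b))"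
    using D(1) by (intro ext prod.cong) auto
  have "bounded (range (\<lambda>x::'a. norm x ^ m * (\<Prod>b\<in>Basis. D b (k b) (x \<bullet> b))))" for k :: "'a \<Rightarrow> nat" and m
  proof -
    obtain B where B: "\<And>x. (1 + norm x) ^ m * \<bar>\<Prod>b\<in>Basis. D b (k b) (x \<bullet> b)\<bar> \<le> B"
      using rapid_prod_Basis[of "\<lambda>b. D b (k b)" m] D(3) by metis
    have "\<bar>norm x ^ m * (\<Prod>b\<in>Basis. D b (k b) (x \<bullet> b))\<bar> \<le> B" for x :: 'a
    proof -
      have "\<bar>norm x ^ m * (\<Prod>b\<in>Basis. D b (k b) (x \<bullet> b))\<bar> \<le> (1 + norm x) ^ m * \<bar>\<Prod>b\<in>Basis. D b (k b) (x \<bullet> b)\<bar>"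
        unfolding abs_mult by (intro mult_mono) (auto intro: power_mono)
      with B[of x] show ?thesis by linarith
    qed
    then show ?thesis by (auto simp: bounded_iff)
  qed
  moreover have "(\<lambda>x. \<Prod>b\<in>Basis. D b (k b) (x \<bullet> b)) differentiable (at x)" for k :: "'a \<Rightarrow> nat" and x
    using has_derivative_prod_Basis[of "\<lambda>b. D b (k b)" "\<lambda>b. D b (Suc (k b))" x] D(2)
    by (auto simp: differentiable_def deriv_seq_def)
  ultimately show ?thesis
    unfolding schwartz_def smooth_fun_def eq using iter_deriv_prod_Basis[of D] D(2) by (simp add: iter_deriv_prod_Basis)
qed

text \<open>As \<open>p\<close> grows, the mass of \<open>\<bar>g\<bar> powr (p - 1)\<close> concentrates at the strict maximum of \<open>\<bar>g\<bar>\<close>.\<close>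
lemma concentration_at_maximum:
  fixes g L :: "'a::euclidean_space \<Rightarrow> real"
  assumes cg: "continuous_on UNIV g" and ig: "integrable lborel g" and dec: "\<And>x. norm x * \<bar>g x\<bar> \<le> B"
    and mx: "\<And>x. x \<noteq> 0 \<Longrightarrow> \<bar>g x\<bar> < g 0"
    and cL: "continuous_on UNIV L" and bL: "\<And>x. \<bar>L x\<bar> \<le> K" and L0: "L 0 < 0"
  obtains p0 where "p0 > 2" "\<And>p. p \<ge> p0 \<Longrightarrow> (\<integral>x. L x * (\<bar>g x\<bar> powr (p - 2)) * g x \<partial>lborel) < 0"
proof -
  have [measurable]: "g \<in> borel_measurable borel" "L \<in> borel_measurable borel"
    using cg cL by (auto intro: borel_measurable_continuous_onI)
  have g0: "g 0 > 0"
  proof -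
    obtain b :: 'a where "b \<in> Basis" using nonempty_Basis by blast
    then have "\<bar>g b\<bar> < g 0" by (intro mx) auto
    then show ?thesis by linarith
  qed
  define c where "c = - L 0 / 2"
  have c: "c > 0" using L0 by (simp add: c_def)
  have "\<forall>\<^sub>F x in nhds 0. L x < - c"
    using cL L0 by (intro order_tendstoD(2)[where y="L 0"])
      (auto simp: c_def continuous_on_eq_continuous_at continuous_at tendsto_at_iff_tendsto_nhds)
  moreover have "\<forall>\<^sub>F x in nhds 0. g x > 0"
    using cg g0 by (intro order_tendstoD(1)[where y="g 0"])
      (auto simp: continuous_on_eq_continuous_at continuous_at tendsto_at_iff_tendsto_nhds)
  ultimately have "\<forall>\<^sub>F x in nhds 0. L x < - c \<and> g x > 0" by eventually_elim auto
  then obtain r where r: "r > 0" "\<And>x. dist x 0 < r \<Longrightarrow> L x < - c \<and> g x > 0"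
    unfolding eventually_nhds_metric by blast
  \<comment> \<open>A gap away from 0: on a compact shell the maximum of |g| is attained and lies
    below \<open>g 0\<close> by strictness; further out the decay bound takes over.\<close>
  obtain q where q: "0 < q" "q < g 0" "\<And>x. norm x \<ge> r \<Longrightarrow> \<bar>g x\<bar> \<le> q"
  proof -
    \<comment> \<open>Beyond \<open>2 * |B| / g 0\<close> the decay hypothesis forces |g| to be at
      most \<open>g 0 / 2\<close>; the maximum with r keeps the shell nonempty.\<close>
    define R where "R = max r (2 * \<bar>B\<bar> / g 0 + 1)"
    have cpt: "compact (cball 0 R - ball 0 r :: 'a set)" by (intro compact_diff) auto
    have ne: "cball 0 R - ball 0 r \<noteq> ({} :: 'a set)"
    proof -
      obtain b :: 'a where "b \<in> Basis" using nonempty_Basis by blast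
      then have "r *\<^sub>R b \<in> cball 0 R - ball 0 r" using r by (auto simp: R_def)
      then show ?thesis by blast
    qed
    have "continuous_on (cball 0 R - ball 0 r) (\<lambda>x. \<bar>g x\<bar>)"
      by (intro continuous_intros continuous_on_subset[OF cg]) auto
    from continuous_attains_sup[OF cpt ne this] obtain z where
      z: "z \<in> cball 0 R - ball 0 r" "\<And>x. x \<in> cball 0 R - ball 0 r \<Longrightarrow> \<bar>g x\<bar> \<le> \<bar>g z\<bar>" by blast
    have "z \<noteq> 0" using z r by auto
    then have gz: "\<bar>g z\<bar> < g 0" by (rule mx)
    show ?thesis
    proof (rule that[of "max \<bar>g z\<bar> (g 0 / 2)"])
      fix x :: 'a assume x: "norm x \<ge> r"
      show "\<bar>g x\<bar> \<le> max \<bar>g z\<bar> (g 0 / 2)"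
      proof (cases "norm x \<le> R")
        case True then have "\<bar>g x\<bar> \<le> \<bar>g z\<bar>" using x by (intro z) auto
        then show ?thesis by simp
      next
        case False
        then have nx: "norm x > 2 * \<bar>B\<bar> / g 0" "norm x > 0" using r by (auto simp: R_def)
        have "2 * \<bar>B\<bar> < norm x * g 0" using nx(1) g0 by (simp add: pos_divide_less_eq)
        then have "norm x * \<bar>g x\<bar> \<le> norm x * (g 0 / 2)"
          using dec[of x] unfolding times_divide_eq_right by linarith
        from mult_left_le_imp_le[OF this nx(2)] show ?thesis by simp
      qed
    qed (use gz g0 in auto)
  qed
  \<comment> \<open>A level strictly between q and \<open>g 0\<close>, exceeded by g on a smaller
    ball: the gain of order \<open>q' powr (p - 1)\<close> there beats the error of order
    \<open>q powr (p - 2)\<close> for large p.\<close>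
  define q' where "q' = (q + g 0) / 2"
  have q': "q < q'" "q' < g 0" using q by (auto simp: q'_def)
  have "\<forall>\<^sub>F x in nhds 0. g x > q'"
    using cg q' by (intro order_tendstoD(1)[where y="g 0"])
      (auto simp: continuous_on_eq_continuous_at continuous_at tendsto_at_iff_tendsto_nhds)
  then obtain r1 where r1: "r1 > 0" "\<And>x. dist x 0 < r1 \<Longrightarrow> g x > q'"
    unfolding eventually_nhds_metric by blast
  define r' where "r' = min r r1"
  have r': "r' > 0" using r r1 by (simp add: r'_def)
  define V where "V = measure lborel (ball (0::'a) r')"
  have V: "V > 0" using r' by (simp add: V_def content_ball_pos)
  define G where "G = (\<integral>x. \<bar>g x\<bar> \<partial>lborel)"
  have G: "G \<ge> 0" by (simp add: G_def)
  have K: "K \<ge> 0" using bL[of 0] by linarith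
  have "LIM t at_top. (q' / q) powr t :> at_top"
    using q q' by real_asymp
  then have "\<forall>\<^sub>F t in at_top. (q' / q) powr t > K * G / (c * q' * V)"
    by (simp add: filterlim_at_top_dense)
  then obtain t0 where t0: "\<And>t. t \<ge> t0 \<Longrightarrow> (q' / q) powr t > K * G / (c * q' * V)"
    by (auto simp: eventually_at_top_linorder)
  show ?thesis
  \<comment> \<open>\<open>t0 + 2\<close> makes the exponent \<open>p - 2\<close> reach t0, and 3
    puts the threshold above 2.\<close>
  proof (rule that[of "max 3 (t0 + 2)"])
    fix p :: real assume p: "p \<ge> max 3 (t0 + 2)"
    let ?h = "\<lambda>x. L x * (\<bar>g x\<bar> powr (p - 2)) * g x"
    \<comment> \<open>A majorant with a definite gain on the small ball. On the rest of the ball of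
      radius r the integrand is already nonpositive, and outside it the last term bounds the
      integrand; that term is nonnegative and may be added everywhere.\<close>
    let ?k = "\<lambda>x. - (c * q' powr (p - 1)) * indicator (ball 0 r') x + K * q powr (p - 2) * \<bar>g x\<bar>"
    have pq: "q' powr (p - 1) = q' powr (p - 2) * q'" 
      using q q' powr_add[of q' "p - 2" 1] by simp
    have bd: "?h x \<le> ?k x" for x
    proof (cases "norm x < r")
      case True
      then have x: "L x < - c" "g x > 0" using r(2)[of x] by auto
      have nn: "K * q powr (p - 2) * \<bar>g x\<bar> \<ge> 0" using K by simp
      show ?thesis
      proof (cases "norm x < r'")
        case True
        then have gx: "g x > q'" using r1(2)[of x] by (simp add: r'_def)
        have "c * q' powr (p - 1) \<le> (- L x) * ((\<bar>g x\<bar> powr (p - 2)) * g x)"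
          unfolding pq using gx x q q' c p
          by (intro mult_mono powr_mono2) auto
        then show ?thesis using True nn by (simp add: mult.assoc)
      next
        case False
        have "?h x \<le> 0" using x c by (intro mult_nonpos_nonneg) auto
        then show ?thesis using False nn by simp
      qed
    next
      case False
      have "?h x \<le> \<bar>L x\<bar> * \<bar>g x\<bar> powr (p - 2) * \<bar>g x\<bar>"
        using abs_ge_self[of "?h x"] by (simp add: abs_mult)
      also have "\<dots> \<le> K * q powr (p - 2) * \<bar>g x\<bar>"
        using False q(3)[of x] K bL p by (intro mult_mono powr_mono2) auto
      finally show ?thesis using False by (simp add: r'_def)
    qed
    have fin: "emeasure lborel (ball (0::'a) r') < top"
      using emeasure_lborel_ball_finite[of "0::'a" r'] by simp
    have ik: "integrable lborel ?k"
      using ig fin by (intro Bochner_Integration.integrable_add integrable_mult_right integrable_abs)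
        (auto simp: integrable_indicator_iff)
    have ih: "integrable lborel ?h"
    proof (rule Bochner_Integration.integrable_bound[where f="\<lambda>x. K * g 0 powr (p - 2) * \<bar>g x\<bar>"])
      show "integrable lborel (\<lambda>x. K * g 0 powr (p - 2) * \<bar>g x\<bar>)" using ig by auto
      have "\<bar>g x\<bar> \<le> g 0" for x using mx[of x] g0 by (cases "x = 0") auto
      then show "AE x in lborel. norm (?h x) \<le> norm (K * g 0 powr (p - 2) * \<bar>g x\<bar>)"
        using K bL p by (intro AE_I2) (auto simp: abs_mult intro!: mult_mono powr_mono2)
    qed measurable
    have "(\<integral>x. ?h x \<partial>lborel) \<le> (\<integral>x. ?k x \<partial>lborel)" by (intro integral_mono ih ik bd)
    also have "\<dots> = - (c * q' powr (p - 1)) * V + K * q powr (p - 2) * G"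
      unfolding V_def G_def using ig fin
      by (subst Bochner_Integration.integral_add) (auto simp: integrable_indicator_iff)
    also have "\<dots> < 0"
    proof -
      have "(q' / q) powr (p - 2) > K * G / (c * q' * V)" using p by (intro t0) simp
      then have "K * G * q powr (p - 2) < q' powr (p - 2) * (c * q' * V)"
        using q q' c V by (simp add: powr_divide field_simps)
      then show ?thesis unfolding pq by (simp add: algebra_simps)
    qed
    finally show "(\<integral>x. ?h x \<partial>lborel) < 0" .
  qed simp
qed

section \<open>Fourier transform and fractional Laplacian\<close>

lemma cis_sum: "finite A \<Longrightarrow> cis (sum f A) = (\<Prod>i\<in>A. cis (f i))"
  by (induction A rule: finite_induct) (auto simp: cis_mult[symmetric])

lemma lborel_integral_scale:
  fixes f :: "'a::euclidean_space \<Rightarrow> 'b::{banach, second_countable_topology}"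
  assumes N: "N > 0" and [measurable]: "f \<in> borel_measurable borel"
  shows "(\<integral>x. f (N *\<^sub>R x) \<partial>lborel) = (1 / N ^ DIM('a)) *\<^sub>R (\<integral>x. f x \<partial>lborel)"
proof -
  have "(\<integral>x. f x \<partial>lborel) = (\<integral>x. f x \<partial>density (distr lborel borel (\<lambda>x::'a. 0 + N *\<^sub>R x)) (\<lambda>_. ennreal (\<bar>N\<bar> ^ DIM('a))))"
    using lborel_affine[of N "0::'a"] N by simp
  also have "\<dots> = (\<integral>x. (\<bar>N\<bar> ^ DIM('a)) *\<^sub>R f x \<partial>distr lborel borel (\<lambda>x::'a. 0 + N *\<^sub>R x))"
    by (subst integral_density) auto
  also have "\<dots> = (\<integral>x. (\<bar>N\<bar> ^ DIM('a)) *\<^sub>R f (0 + N *\<^sub>R x) \<partial>lborel)"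
    by (subst integral_distr) auto
  also have "\<dots> = N ^ DIM('a) *\<^sub>R (\<integral>x. f (N *\<^sub>R x) \<partial>lborel)"
    using N by simp
  finally show ?thesis using N by simp
qed

lemma lborel_translate:
  fixes f :: "'a::euclidean_space \<Rightarrow> 'b::{banach, second_countable_topology}"
  assumes [measurable]: "f \<in> borel_measurable borel"
  shows "integrable lborel (\<lambda>x. f (a + x)) \<longleftrightarrow> integrable lborel f"
    and "(\<integral>x. f (a + x) \<partial>lborel) = (\<integral>x. f x \<partial>lborel)"
proof -
  have "integrable (distr lborel borel ((+) a)) f \<longleftrightarrow> integrable lborel (\<lambda>x. f (a + x))"
    by (rule integrable_distr_eq) auto
  then show "integrable lborel (\<lambda>x. f (a + x)) \<longleftrightarrow> integrable lborel f"
    by (simp add: lborel_distr_plus)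
  have "integral\<^sup>L (distr lborel borel ((+) a)) f = (\<integral>x. f (a + x) \<partial>lborel)"
    by (rule integral_distr) auto
  then show "(\<integral>x. f (a + x) \<partial>lborel) = (\<integral>x. f x \<partial>lborel)"
    by (simp add: lborel_distr_plus)
qed

lemma fourier_integrand:
  fixes f :: "'a::euclidean_space \<Rightarrow> real"
  assumes "integrable lborel f"
  shows "integrable lborel (\<lambda>x. complex_of_real (f x) * cis (- (\<xi> \<bullet> x)))"
  by (rule integrable_mult_cis) (use assms in auto)

lemma fourier_cos_mult:
  fixes f :: "'a::euclidean_space \<Rightarrow> real"
  assumes i: "integrable lborel f"
  shows "fourier (\<lambda>x. cos (c * (x \<bullet> e)) * f x) \<xi> = (fourier f (\<xi> - c *\<^sub>R e) + fourier f (\<xi> + c *\<^sub>R e)) / 2"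
proof -
  have "complex_of_real (cos (c * (x \<bullet> e)) * f x) * cis (- (\<xi> \<bullet> x)) =
     (complex_of_real (f x) * cis (- ((\<xi> - c *\<^sub>R e) \<bullet> x)) + complex_of_real (f x) * cis (- ((\<xi> + c *\<^sub>R e) \<bullet> x))) / 2" for x
  proof -
    have "cis (- ((\<xi> - c *\<^sub>R e) \<bullet> x)) = cis (- (\<xi> \<bullet> x)) * cis (c * (x \<bullet> e))"
         "cis (- ((\<xi> + c *\<^sub>R e) \<bullet> x)) = cis (- (\<xi> \<bullet> x)) * cis (- (c * (x \<bullet> e)))"
      by (simp_all add: cis_mult inner_diff_left inner_add_left inner_commute[of e x] algebra_simps)
    moreover have "complex_of_real (cos (c * (x \<bullet> e))) = (cis (c * (x \<bullet> e)) + cis (- (c * (x \<bullet> e)))) / 2"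
      by (simp add: complex_eq_iff)
    ultimately show ?thesis by (simp only: of_real_mult) (simp add: algebra_simps add_divide_distrib)
  qed
  then have "fourier (\<lambda>x. cos (c * (x \<bullet> e)) * f x) \<xi> = 
     (\<integral>x. (complex_of_real (f x) * cis (- ((\<xi> - c *\<^sub>R e) \<bullet> x)) + complex_of_real (f x) * cis (- ((\<xi> + c *\<^sub>R e) \<bullet> x))) / 2 \<partial>lborel)"
    unfolding fourier_def by (intro Bochner_Integration.integral_cong) auto
  also have "\<dots> = (fourier f (\<xi> - c *\<^sub>R e) + fourier f (\<xi> + c *\<^sub>R e)) / 2"
    unfolding fourier_def integral_divide_zero
    by (subst Bochner_Integration.integral_add[OF fourier_integrand[OF i] fourier_integrand[OF i]]) simp
  finally show ?thesis .
qed

lemma fourier_prod_Basis: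
  fixes \<xi> :: "'a::euclidean_space"
  assumes i: "integrable lborel u" and F: "\<And>t. fourier u t = complex_of_real (v t)"
  shows "fourier (\<lambda>x::'a. \<Prod>b\<in>Basis. u (x \<bullet> b)) \<xi> = complex_of_real (\<Prod>b\<in>Basis. v (\<xi> \<bullet> b))"
proof -
  have "complex_of_real (\<Prod>b\<in>Basis. u (x \<bullet> b)) * cis (- (\<xi> \<bullet> x))
      = (\<Prod>b\<in>Basis. complex_of_real (u (x \<bullet> b)) * cis (- ((\<xi> \<bullet> b) \<bullet> (x \<bullet> b))))" for x
  proof -
    have "- (\<xi> \<bullet> x) = (\<Sum>b\<in>Basis. - ((\<xi> \<bullet> b) \<bullet> (x \<bullet> b)))"
      by (subst euclidean_inner) (simp add: sum_negf)
    then show ?thesis by (simp only: cis_sum finite_Basis prod.distrib of_real_prod)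
  qed
  then have "fourier (\<lambda>x::'a. \<Prod>b\<in>Basis. u (x \<bullet> b)) \<xi> 
     = (\<integral>x. (\<Prod>b\<in>Basis. complex_of_real (u (x \<bullet> b)) * cis (- ((\<xi> \<bullet> b) \<bullet> (x \<bullet> b)))) \<partial>lborel)"
    unfolding fourier_def by (intro Bochner_Integration.integral_cong) auto
  also have "\<dots> = (\<Prod>b\<in>Basis. fourier u (\<xi> \<bullet> b))"
    unfolding fourier_def
    by (rule lborel_integral_prod_Basis(2)[where f="\<lambda>b t. complex_of_real (u t) * cis (- ((\<xi> \<bullet> b) \<bullet> t))"])
       (rule fourier_integrand[OF i])
  finally show ?thesis by (simp add: F)
qed

text \<open>Integrability of the weighted transform gives continuity by dominated convergence and a
  bound by its L1 norm. These are the hypotheses on L in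
  \<open>concentration_at_maximum\<close>.\<close>

lemma frac_lap_continuous_bounded:
  fixes f :: "'a::euclidean_space \<Rightarrow> real"
  assumes i: "integrable lborel (\<lambda>\<xi>. complex_of_real (norm \<xi> powr s) * fourier f \<xi>)"
  shows "continuous_on UNIV (frac_lap s f)" and "\<exists>K. \<forall>x. \<bar>frac_lap s f x\<bar> \<le> K"
proof -
  let ?h = "\<lambda>\<xi>. complex_of_real (norm \<xi> powr s) * fourier f \<xi>"
  let ?I = "\<lambda>x. \<integral>\<xi>. ?h \<xi> * cis (\<xi> \<bullet> x) \<partial>lborel"
  have [measurable]: "?h \<in> borel_measurable borel" using i by auto
  have ii: "integrable lborel (\<lambda>\<xi>. ?h \<xi> * cis (\<xi> \<bullet> x))" for x
    by (rule integrable_mult_cis[OF i]) measurable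
  have "continuous_on UNIV ?I"
  proof (rule continuous_at_imp_continuous_on, rule ballI, unfold continuous_at_sequentially comp_def, intro allI impI)
    fix x :: 'a and X assume X: "X \<longlonglongrightarrow> x"
    show "(\<lambda>n. ?I (X n)) \<longlonglongrightarrow> ?I x"
    proof (rule integral_dominated_convergence[where w="\<lambda>\<xi>. norm (?h \<xi>)"])
      show "AE \<xi> in lborel. (\<lambda>n. ?h \<xi> * cis (\<xi> \<bullet> X n)) \<longlonglongrightarrow> ?h \<xi> * cis (\<xi> \<bullet> x)"
      proof (rule AE_I2)
        fix \<xi>
        have "(\<lambda>n. cis (\<xi> \<bullet> X n)) \<longlonglongrightarrow> cis (\<xi> \<bullet> x)"
          by (intro continuous_on_tendsto_compose[where f=cis and s=UNIV] continuous_intros tendsto_intros X) auto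
        then show "(\<lambda>n. ?h \<xi> * cis (\<xi> \<bullet> X n)) \<longlonglongrightarrow> ?h \<xi> * cis (\<xi> \<bullet> x)" by (rule tendsto_mult_left)
      qed
      show "integrable lborel (\<lambda>\<xi>. norm (?h \<xi>))" using i by (rule integrable_norm)
      show "AE \<xi> in lborel. norm (?h \<xi> * cis (\<xi> \<bullet> X n)) \<le> norm (?h \<xi>)" for n
        by (simp add: norm_mult)
    qed (use ii in \<open>auto intro!: borel_measurable_integrable\<close>)
  qed
  then show "continuous_on UNIV (frac_lap s f)"
    unfolding frac_lap_def[abs_def] by (intro continuous_intros) auto
  have "\<bar>frac_lap s f x\<bar> \<le> (\<integral>\<xi>. norm (?h \<xi>) \<partial>lborel) / (2 * pi) ^ DIM('a)" for x
  proof -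
    have "\<bar>frac_lap s f x\<bar> \<le> norm (?I x / complex_of_real ((2 * pi) ^ DIM('a)))"
      unfolding frac_lap_def by (rule abs_Re_le_cmod)
    also have "\<dots> = norm (?I x) / (2 * pi) ^ DIM('a)"
      by (simp only: norm_divide norm_of_real) simp
    also have "\<dots> \<le> (\<integral>\<xi>. norm (?h \<xi> * cis (\<xi> \<bullet> x)) \<partial>lborel) / (2 * pi) ^ DIM('a)"
      by (intro divide_right_mono integral_norm_bound) auto
    finally show ?thesis by (simp add: norm_mult)
  qed
  then show "\<exists>K. \<forall>x. \<bar>frac_lap s f x\<bar> \<le> K" by blast
qed

lemma fourier_scale:
  fixes f :: "'a::euclidean_space \<Rightarrow> real"
  assumes N: "N > 0" and [measurable]: "f \<in> borel_measurable borel"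
  shows "fourier (\<lambda>x. f (N *\<^sub>R x)) \<xi> = (1 / N ^ DIM('a)) *\<^sub>R fourier f ((1 / N) *\<^sub>R \<xi>)"
proof -
  have [measurable]: "cis \<in> borel_measurable borel"
    by (intro borel_measurable_continuous_onI continuous_intros)
  have "fourier (\<lambda>x. f (N *\<^sub>R x)) \<xi> = (\<integral>x. complex_of_real (f (N *\<^sub>R x)) * cis (- (((1 / N) *\<^sub>R \<xi>) \<bullet> (N *\<^sub>R x))) \<partial>lborel)"
    unfolding fourier_def using N by simp
  also have "\<dots> = (1 / N ^ DIM('a)) *\<^sub>R fourier f ((1 / N) *\<^sub>R \<xi>)"
    unfolding fourier_def by (rule lborel_integral_scale[OF N]) measurable
  finally show ?thesis .
qed

text \<open>Homogeneity of the symbol contributes \<open>N powr s\<close>, while the factor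
  \<open>1 / N ^ DIM('a)\<close> from the transform of the dilated function cancels the
  Jacobian.\<close>

lemma frac_lap_scale:
  fixes f :: "'a::euclidean_space \<Rightarrow> real"
  assumes N: "N > 0" and [measurable]: "f \<in> borel_measurable borel" "fourier f \<in> borel_measurable borel"
  shows "frac_lap s (\<lambda>x. f (N *\<^sub>R x)) x = N powr s * frac_lap s f (N *\<^sub>R x)"
proof -
  have [measurable]: "cis \<in> borel_measurable borel"
    by (intro borel_measurable_continuous_onI continuous_intros)
  let ?J = "\<lambda>y. \<integral>\<xi>. complex_of_real (norm \<xi> powr s) * fourier f \<xi> * cis (\<xi> \<bullet> y) \<partial>lborel"
  let ?g = "\<lambda>\<eta>. complex_of_real (N powr s / N ^ DIM('a)) * (complex_of_real (norm \<eta> powr s) * fourier f \<eta> * cis (\<eta> \<bullet> (N *\<^sub>R x)))"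
  have "(\<integral>\<xi>. complex_of_real (norm \<xi> powr s) * fourier (\<lambda>x. f (N *\<^sub>R x)) \<xi> * cis (\<xi> \<bullet> x) \<partial>lborel)
      = (\<integral>\<xi>. ?g ((1 / N) *\<^sub>R \<xi>) \<partial>lborel)"
  proof (rule Bochner_Integration.integral_cong[OF refl])
    fix \<xi> :: 'a
    have "norm \<xi> powr s = N powr s * (norm ((1 / N) *\<^sub>R \<xi>) powr s)"
      using N by (simp add: powr_divide)
    moreover have "((1 / N) *\<^sub>R \<xi>) \<bullet> (N *\<^sub>R x) = \<xi> \<bullet> x" using N by simp
    ultimately show "complex_of_real (norm \<xi> powr s) * fourier (\<lambda>x. f (N *\<^sub>R x)) \<xi> * cis (\<xi> \<bullet> x) = ?g ((1 / N) *\<^sub>R \<xi>)"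
      by (simp only: fourier_scale[OF N assms(2)] scaleR_conv_of_real of_real_mult of_real_divide of_real_1 times_divide_eq_left times_divide_eq_right mult_1_left ac_simps)
  qed
  also have "\<dots> = (1 / (1 / N) ^ DIM('a)) *\<^sub>R (\<integral>\<eta>. ?g \<eta> \<partial>lborel)"
    by (rule lborel_integral_scale) (use N in auto)
  also have "(\<integral>\<eta>. ?g \<eta> \<partial>lborel) = complex_of_real (N powr s / N ^ DIM('a)) * ?J (N *\<^sub>R x)"
    by (rule integral_mult_right_zero)
  also have "(1 / (1 / N) ^ DIM('a)) *\<^sub>R \<dots> = complex_of_real (N powr s) * ?J (N *\<^sub>R x)"
    using N by (simp add: scaleR_conv_of_real power_divide)
  finally have e: "(\<integral>\<xi>. complex_of_real (norm \<xi> powr s) * fourier (\<lambda>x. f (N *\<^sub>R x)) \<xi> * cis (\<xi> \<bullet> x) \<partial>lborel)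
      = complex_of_real (N powr s) * ?J (N *\<^sub>R x)" .
  have "Re (complex_of_real a * z / w) = a * Re (z / w)" for a z w
    unfolding times_divide_eq_left[symmetric] by (simp flip: times_divide_eq_right)
  then show ?thesis unfolding frac_lap_def e .
qed

section \<open>The localised wave\<close>

definition tensor :: "(real \<Rightarrow> real) \<Rightarrow> 'a::euclidean_space \<Rightarrow> real" where
  "tensor u x = (\<Prod>b\<in>Basis. u (x \<bullet> b))"

definition carrier_wave :: "real \<Rightarrow> real \<Rightarrow> real" where
  "carrier_wave k t = cos t - 1 / (2 * k\<^sup>2) * cos (k * t)"

definition wave :: "(real \<Rightarrow> real) \<Rightarrow> 'a \<Rightarrow> real \<Rightarrow> 'a::euclidean_space \<Rightarrow> real" where
  "wave u e k x = carrier_wave k (x \<bullet> e) * tensor u x"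

definition wave_hat :: "(real \<Rightarrow> real) \<Rightarrow> 'a \<Rightarrow> real \<Rightarrow> 'a::euclidean_space \<Rightarrow> real" where
  "wave_hat v e k \<xi> = (tensor v (\<xi> - e) + tensor v (\<xi> + e)) / 2
     - 1 / (2 * k\<^sup>2) * ((tensor v (\<xi> - k *\<^sub>R e) + tensor v (\<xi> + k *\<^sub>R e)) / 2)"

section \<open>The maximum of the carrier wave\<close>

lemma abs_sin_mult_le: "\<bar>sin (real n * t)\<bar> \<le> real n * \<bar>sin t\<bar>"
proof (induction n)
  case (Suc n)
  have "\<bar>sin (real (Suc n) * t)\<bar> = \<bar>sin (real n * t) * cos t + cos (real n * t) * sin t\<bar>"
    by (simp add: sin_add distrib_right add.commute[of t])
  also have "\<dots> \<le> \<bar>sin (real n * t)\<bar> * \<bar>cos t\<bar> + \<bar>cos (real n * t)\<bar> * \<bar>sin t\<bar>"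
    by (metis abs_mult abs_triangle_ineq)
  also have "\<dots> \<le> \<bar>sin (real n * t)\<bar> * 1 + 1 * \<bar>sin t\<bar>"
    by (intro add_mono mult_left_mono mult_right_mono) auto
  also have "\<dots> \<le> real (Suc n) * \<bar>sin t\<bar>" using Suc by (simp add: algebra_simps)
  finally show ?case .
qed simp

text \<open>By the half-angle formula, \<open>|sin (n * y)| <= n * |sin y|\<close> becomes
  \<open>1 - cos (n * t) <= n^2 * (1 - cos t)\<close>. With coefficient \<open>1 / (2 * n^2)\<close>
  the second cosine recovers at most half of what the first one loses.\<close>

lemma carrier_wave_le:
  assumes "n > 0" shows "carrier_wave (real n) t \<le> carrier_wave (real n) 0"
proof -
  have c: "1 - cos y = 2 * (sin (y / 2))\<^sup>2" for y :: real
    using cos_double_sin[of "y / 2"] by simp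
  have "\<bar>sin (real n * (t / 2))\<bar> \<le> real n * \<bar>sin (t / 2)\<bar>" by (rule abs_sin_mult_le)
  then have "(sin (real n * (t / 2)))\<^sup>2 \<le> (real n * \<bar>sin (t / 2)\<bar>)\<^sup>2"
    by (metis abs_ge_zero power2_abs power_mono)
  then have "1 - cos (real n * t) \<le> (real n)\<^sup>2 * (1 - cos t)"
    unfolding c by (simp add: power_mult_distrib)
  then have "1 / (2 * (real n)\<^sup>2) * (1 - cos (real n * t)) \<le> 1 / (2 * (real n)\<^sup>2) * ((real n)\<^sup>2 * (1 - cos t))"
    by (intro mult_left_mono) auto
  also have "\<dots> = (1 - cos t) / 2" using assms by simp
  also have "\<dots> \<le> 1 - cos t" by simp
  finally show ?thesis by (simp add: carrier_wave_def right_diff_distrib)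
qed

text \<open>For odd frequency ratio, translation by \<open>pi\<close> flips the sign of the carrier wave.\<close>
lemma abs_carrier_wave_le:
  assumes "odd n" shows "\<bar>carrier_wave (real n) t\<bar> \<le> carrier_wave (real n) 0"
proof -
  have n: "n > 0" using assms by (auto intro: Nat.gr0I)
  obtain m where m: "n = 2 * m + 1" using assms by (rule oddE)
  have "cos (real n * (t + pi)) = cos (real n * t + pi + of_nat m * (2 * of_real pi))"
    by (simp add: m algebra_simps)
  also have "\<dots> = cos (real n * t + pi)"
    by (rule cos.plus_of_nat)
  also have "\<dots> = - cos (real n * t)" by simp
  finally have "carrier_wave (real n) (t + pi) = - carrier_wave (real n) t"
    by (simp add: carrier_wave_def)
  then show ?thesis using carrier_wave_le[OF n, of t] carrier_wave_le[OF n, of "t + pi"] by linarith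
qed

lemma carrier_wave_0_pos: "n > 0 \<Longrightarrow> carrier_wave (real n) 0 > 0"
proof -
  assume "n > 0"
  then have "(real n)\<^sup>2 \<ge> 1" by (simp add: one_le_power)
  then have "1 / (2 * (real n)\<^sup>2) \<le> 1 / 2" using \<open>n > 0\<close> by (intro divide_left_mono) auto
  then show ?thesis by (simp add: carrier_wave_def)
qed

lemma schwartz1_carrier_wave_mult:
  assumes "schwartz1 u" shows "schwartz1 (\<lambda>t. carrier_wave k t * u t)"
proof -
  have "schwartz1 (\<lambda>t. 1 * (cos (1 * t) * u t) + (- (1 / (2 * k\<^sup>2))) * (cos (k * t) * u t))"
    by (intro schwartz1_lincomb schwartz1_trig assms)
  then show ?thesis by (simp add: carrier_wave_def left_diff_distrib mult.assoc)
qed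

text \<open>The carrier depends on one coordinate only and is absorbed into a single factor, so the
  coordinatewise lemmas apply to the wave itself.\<close>

lemma wave_as_product:
  fixes e :: "'a::euclidean_space"
  assumes "e \<in> Basis"
  shows "wave u e k x = (\<Prod>b\<in>Basis. (if b = e then \<lambda>t. carrier_wave k t * u t else u) (x \<bullet> b))"
proof -
  have "(\<Prod>b\<in>Basis - {e}. (if b = e then \<lambda>t. carrier_wave k t * u t else u) (x \<bullet> b)) = (\<Prod>b\<in>Basis - {e}. u (x \<bullet> b))"
    by (intro prod.cong) auto
  then show ?thesis using assms
    by (simp add: wave_def tensor_def prod.remove[of Basis e])
qed

lemma schwartz_wave:
  fixes e :: "'a::euclidean_space"
  assumes "schwartz1 u" "e \<in> Basis" "N \<ge> 1"
  shows "schwartz (\<lambda>x. wave u e k (N *\<^sub>R x))"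
proof -
  let ?F = "\<lambda>b t. (if b = e then \<lambda>t. carrier_wave k t * u t else u) (N * t)"
  have "schwartz (\<lambda>x::'a. \<Prod>b\<in>Basis. ?F b (x \<bullet> b))"
    by (rule schwartz_prod_Basis) (use assms in \<open>auto intro!: schwartz1_scale schwartz1_carrier_wave_mult\<close>)
  moreover have "(\<lambda>x. wave u e k (N *\<^sub>R x)) = (\<lambda>x::'a. \<Prod>b\<in>Basis. ?F b (x \<bullet> b))"
    by (rule ext) (simp add: wave_as_product[OF assms(2)])
  ultimately show ?thesis by simp
qed

lemma continuous_on_tensor: "continuous_on UNIV u \<Longrightarrow> continuous_on S (tensor u)"
  unfolding tensor_def[abs_def]
  by (intro continuous_on_prod continuous_on_compose2[where g=u and t=UNIV and s=S] continuous_on_inner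
      continuous_on_id continuous_on_const) auto

lemma powr_le_power_ceiling:
  fixes y :: real assumes "y \<ge> 1" shows "y powr s \<le> y ^ nat \<lceil>s\<rceil>"
proof -
  have "y powr s \<le> y powr real (nat \<lceil>s\<rceil>)"
    using assms by (intro powr_mono real_nat_ceiling_ge) auto
  then show ?thesis using assms by (simp add: powr_realpow)
qed

section \<open>Spectrum and fractional Laplacian of a wave over a fixed profile\<close>

context
  fixes u v :: "real \<Rightarrow> real" and e :: "'a::euclidean_space" and k :: real
  assumes p: "profile u v" and e: "e \<in> Basis" and k: "k \<ge> 1"
begin

lemma profile_facts:
  shows profile_schwartz1: "schwartz1 u" and profile_continuous: "continuous_on UNIV u" and profile_integrable: "integrable lborel u"
    and profile_hat_continuous: "continuous_on UNIV v" and profile_hat_rapid: "rapid v" and profile_hat_nonneg: "v t \<ge> 0"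
  using p unfolding profile_def
  by (auto intro: smooth1_continuous schwartz1_smooth1 rapid_integrable schwartz1_rapid)

lemma tensor_v_nonneg: "tensor v (\<xi>::'a) \<ge> 0"
  unfolding tensor_def by (intro prod_nonneg) (auto intro: profile_hat_nonneg)

lemma fourier_tensor: "fourier (tensor u) (\<xi>::'a) = complex_of_real (tensor v \<xi>)"
  unfolding tensor_def[abs_def]
  by (rule fourier_prod_Basis[OF profile_integrable]) (use p in \<open>auto simp: profile_def\<close>)

lemma integrable_tensor_u: "integrable lborel (tensor u :: 'a \<Rightarrow> real)"
  unfolding tensor_def[abs_def] by (rule lborel_integral_prod_Basis(1)[of "\<lambda>_. u"]) (rule profile_integrable)

lemma integrable_wave: "integrable lborel (wave u e k)"
proof -
  have "integrable lborel (\<lambda>x::'a. \<Prod>b\<in>Basis. (if b = e then \<lambda>t. carrier_wave k t * u t else u) (x \<bullet> b))"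
    by (rule lborel_integral_prod_Basis(1))
      (auto intro!: profile_integrable rapid_integrable schwartz1_rapid smooth1_continuous schwartz1_smooth1 schwartz1_carrier_wave_mult profile_schwartz1)
  then show ?thesis by (simp add: wave_as_product[OF e, abs_def])
qed

lemma continuous_on_wave: "continuous_on UNIV (wave u e k)"
  unfolding wave_def[abs_def] carrier_wave_def
  by (intro continuous_intros continuous_on_tensor profile_continuous)

lemma fourier_wave: "fourier (wave u e k) \<xi> = complex_of_real (wave_hat v e k \<xi>)"
proof -
  let ?f = "\<lambda>c x::'a. cos (c * (x \<bullet> e)) * tensor u x"
  have i: "integrable lborel (?f c)" for c
  proof (rule Bochner_Integration.integrable_bound[OF integrable_tensor_u])
    show "?f c \<in> borel_measurable lborel"
      using integrable_tensor_u by (intro borel_measurable_times) auto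
    show "AE x in lborel. norm (?f c x) \<le> norm (tensor u x)"
      by (auto simp: abs_mult mult_left_le_one_le)
  qed
  have "fourier (wave u e k) \<xi> = (\<integral>x. complex_of_real (?f 1 x) * cis (- (\<xi> \<bullet> x)) - complex_of_real (1 / (2 * k\<^sup>2)) * (complex_of_real (?f k x) * cis (- (\<xi> \<bullet> x))) \<partial>lborel)"
    unfolding fourier_def wave_def carrier_wave_def
    by (intro Bochner_Integration.integral_cong) (auto simp: algebra_simps)
  also have "\<dots> = fourier (?f 1) \<xi> - complex_of_real (1 / (2 * k\<^sup>2)) * fourier (?f k) \<xi>"
    unfolding fourier_def
    by (subst Bochner_Integration.integral_diff[OF fourier_integrand[OF i] integrable_mult_right[OF fourier_integrand[OF i]]])
       (simp only: integral_mult_right_zero)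
  also have "\<dots> = complex_of_real (wave_hat v e k \<xi>)"
    unfolding fourier_cos_mult[OF integrable_tensor_u] fourier_tensor wave_hat_def by simp
  finally show ?thesis .
qed

text \<open>Rounding s up to an integer m, the weight is dominated by a product of m-th powers of
  one-dimensional weights, each integrable against v by rapid decay.\<close>

lemma integrable_weight_tensor:
  assumes s: "s > 0"
  shows "integrable lborel (\<lambda>\<xi>::'a. (1 + norm \<xi>) powr s * tensor v \<xi>)"
proof (rule Bochner_Integration.integrable_bound)
  let ?m = "nat \<lceil>s\<rceil>"
  have [measurable]: "v \<in> borel_measurable borel" using profile_hat_continuous by (rule borel_measurable_continuous_onI)
  show "integrable lborel (\<lambda>\<xi>::'a. \<Prod>b\<in>Basis. (1 + \<bar>\<xi> \<bullet> b\<bar>) ^ ?m * \<bar>v (\<xi> \<bullet> b)\<bar>)"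
    by (rule lborel_integral_prod_Basis(1)[of "\<lambda>_ t. (1 + \<bar>t\<bar>) ^ ?m * \<bar>v t\<bar>"])
       (rule rapid_measurable_integrable[OF profile_hat_rapid], measurable)
  show "(\<lambda>\<xi>::'a. (1 + norm \<xi>) powr s * tensor v \<xi>) \<in> borel_measurable lborel"
    unfolding tensor_def by measurable
  show "AE \<xi>::'a in lborel. norm ((1 + norm \<xi>) powr s * tensor v \<xi>) \<le> norm (\<Prod>b\<in>Basis. (1 + \<bar>\<xi> \<bullet> b\<bar>) ^ ?m * \<bar>v (\<xi> \<bullet> b)\<bar>)"
  proof (rule AE_I2)
    fix \<xi> :: 'a
    have "(1 + norm \<xi>) powr s * tensor v \<xi> \<le> (\<Prod>b\<in>Basis. 1 + \<bar>\<xi> \<bullet> b\<bar>) ^ ?m * tensor v \<xi>"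
    proof (intro mult_right_mono tensor_v_nonneg)
      have "(1 + norm \<xi>) powr s \<le> (1 + norm \<xi>) ^ ?m" by (rule powr_le_power_ceiling) simp
      also have "\<dots> \<le> (\<Prod>b\<in>Basis. 1 + \<bar>\<xi> \<bullet> b\<bar>) ^ ?m" by (intro power_mono one_plus_norm_le_prod) auto
      finally show "(1 + norm \<xi>) powr s \<le> (\<Prod>b\<in>Basis. 1 + \<bar>\<xi> \<bullet> b\<bar>) ^ ?m" .
    qed
    also have "\<dots> = (\<Prod>b\<in>Basis. (1 + \<bar>\<xi> \<bullet> b\<bar>) ^ ?m * \<bar>v (\<xi> \<bullet> b)\<bar>)"
      by (simp add: tensor_def prod_power_distrib prod.distrib profile_hat_nonneg)
    finally show "norm ((1 + norm \<xi>) powr s * tensor v \<xi>) \<le> norm (\<Prod>b\<in>Basis. (1 + \<bar>\<xi> \<bullet> b\<bar>) ^ ?m * \<bar>v (\<xi> \<bullet> b)\<bar>)"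
      using tensor_v_nonneg[of \<xi>] by simp
  qed
qed

text \<open>Translation moves the shift from the spectrum to the weight, so that the four copies in
  \<open>wave_hat\<close> become four weights against the same density \<open>tensor v\<close>.
  Integrability rests on \<open>norm (xi + a) <= (1 + norm a) * (1 + norm xi)\<close>.\<close>

lemma shifted_weight:
  fixes a :: 'a assumes s: "s > 0"
  shows "integrable lborel (\<lambda>\<xi>. norm (\<xi> + a) powr s * tensor v \<xi>)"
    and "integrable lborel (\<lambda>\<xi>. norm \<xi> powr s * tensor v (\<xi> - a))"
    and "(\<integral>\<xi>. norm \<xi> powr s * tensor v (\<xi> - a) \<partial>lborel) = (\<integral>\<xi>. norm (\<xi> + a) powr s * tensor v \<xi> \<partial>lborel)"
proof -
  have [measurable]: "tensor v \<in> borel_measurable (borel :: 'a measure)"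
    using continuous_on_tensor[OF profile_hat_continuous] by (rule borel_measurable_continuous_onI)
  show 1: "integrable lborel (\<lambda>\<xi>. norm (\<xi> + a) powr s * tensor v \<xi>)"
  proof (rule Bochner_Integration.integrable_bound)
    show "integrable lborel (\<lambda>\<xi>::'a. (1 + norm a) powr s * ((1 + norm \<xi>) powr s * tensor v \<xi>))"
      by (intro integrable_mult_right integrable_weight_tensor s)
    show "AE \<xi> in lborel. norm (norm (\<xi> + a) powr s * tensor v \<xi>) \<le> norm ((1 + norm a) powr s * ((1 + norm \<xi>) powr s * tensor v \<xi>))"
    proof (rule AE_I2)
      fix \<xi> :: 'a
      have "norm (\<xi> + a) \<le> (1 + norm a) * (1 + norm \<xi>)"
      proof -
        have "(1 + norm a) * (1 + norm \<xi>) = 1 + norm a + norm \<xi> + norm a * norm \<xi>" by (simp add: algebra_simps)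
        moreover have "0 \<le> norm a * norm \<xi>" by simp
        ultimately show ?thesis using norm_triangle_ineq[of \<xi> a] by linarith
      qed
      then have "norm (\<xi> + a) powr s \<le> ((1 + norm a) * (1 + norm \<xi>)) powr s" using s by (intro powr_mono2) auto
      also have "\<dots> = (1 + norm a) powr s * (1 + norm \<xi>) powr s" by (rule powr_mult) 
      finally have "norm (\<xi> + a) powr s * tensor v \<xi> \<le> (1 + norm a) powr s * (1 + norm \<xi>) powr s * tensor v \<xi>"
        by (intro mult_right_mono tensor_v_nonneg)
      then show "norm (norm (\<xi> + a) powr s * tensor v \<xi>) \<le> norm ((1 + norm a) powr s * ((1 + norm \<xi>) powr s * tensor v \<xi>))"
        using tensor_v_nonneg[of \<xi>] by (simp add: mult.assoc)
    qed
  qed measurable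
  have m: "(\<lambda>\<xi>. norm (\<xi> + a) powr s * tensor v \<xi>) \<in> borel_measurable borel" by measurable
  show "integrable lborel (\<lambda>\<xi>. norm \<xi> powr s * tensor v (\<xi> - a))"
    using lborel_translate(1)[OF m, of "- a"] 1 by simp
  show "(\<integral>\<xi>. norm \<xi> powr s * tensor v (\<xi> - a) \<partial>lborel) = (\<integral>\<xi>. norm (\<xi> + a) powr s * tensor v \<xi> \<partial>lborel)"
    using lborel_translate(2)[OF m, of "- a"] by simp
qed

lemma integrable_weight_wave_hat:
  assumes s: "s > 0" shows "integrable lborel (\<lambda>\<xi>. norm \<xi> powr s * wave_hat v e k \<xi>)"
proof -
  let ?I = "\<lambda>a \<xi>. norm \<xi> powr s * tensor v (\<xi> - a)"
  have "integrable lborel (\<lambda>\<xi>. (?I e \<xi> + ?I (- e) \<xi>) / 2 - 1 / (2 * k\<^sup>2) * ((?I (k *\<^sub>R e) \<xi> + ?I (- (k *\<^sub>R e)) \<xi>) / 2))"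
    by (intro Bochner_Integration.integrable_diff integrable_mult_right integrable_divide_zero Bochner_Integration.integrable_add shifted_weight s)
  then show ?thesis unfolding wave_hat_def by (simp add: algebra_simps)
qed

text \<open>After translation everything is integrated against the single nonnegative function
  \<open>tensor v\<close>, so a pointwise comparison of weights is enough. The first integral on the
  right is independent of k, whereas the coefficient of the second grows with k once s > 2.\<close>

lemma integral_weight_wave_hat_le:
  assumes s: "s > 0"
  shows "(\<integral>\<xi>. norm \<xi> powr s * wave_hat v e k \<xi> \<partial>lborel)
    \<le> (\<integral>\<xi>. (1 + norm (\<xi>::'a)) powr s * tensor v \<xi> \<partial>lborel) - k powr (s - 2) / 4 * (\<integral>\<xi>. tensor v (\<xi>::'a) \<partial>lborel)"
proof -
  let ?I = "\<lambda>a \<xi>. norm \<xi> powr s * tensor v (\<xi> - a)"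
  let ?J = "\<lambda>a \<xi>. norm (\<xi> + a) powr s * tensor v \<xi>"
  have it: "integrable lborel (tensor v :: 'a \<Rightarrow> real)"
    unfolding tensor_def[abs_def] by (rule lborel_integral_prod_Basis(1)[of "\<lambda>_. v"]) (intro rapid_integrable profile_hat_rapid profile_hat_continuous)
  have "(\<integral>\<xi>. norm \<xi> powr s * wave_hat v e k \<xi> \<partial>lborel)
      = (\<integral>\<xi>. (?I e \<xi> + ?I (- e) \<xi>) / 2 - 1 / (2 * k\<^sup>2) * ((?I (k *\<^sub>R e) \<xi> + ?I (- (k *\<^sub>R e)) \<xi>) / 2) \<partial>lborel)"
    unfolding wave_hat_def by (intro Bochner_Integration.integral_cong) (auto simp: algebra_simps)
  also have "\<dots> = (\<integral>\<xi>. (?J e \<xi> + ?J (- e) \<xi>) / 2 - 1 / (2 * k\<^sup>2) * ((?J (k *\<^sub>R e) \<xi> + ?J (- (k *\<^sub>R e)) \<xi>) / 2) \<partial>lborel)"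
    by (simp only: Bochner_Integration.integral_diff Bochner_Integration.integral_add integral_mult_right_zero integral_divide_zero
      Bochner_Integration.integrable_diff integrable_mult_right integrable_divide_zero Bochner_Integration.integrable_add shifted_weight[OF s])
  also have "\<dots> \<le> (\<integral>\<xi>. (1 + norm (\<xi>::'a)) powr s * tensor v \<xi> - k powr (s - 2) / 4 * tensor v \<xi> \<partial>lborel)"
  proof (rule integral_mono)
    show "integrable lborel (\<lambda>\<xi>. (?J e \<xi> + ?J (- e) \<xi>) / 2 - 1 / (2 * k\<^sup>2) * ((?J (k *\<^sub>R e) \<xi> + ?J (- (k *\<^sub>R e)) \<xi>) / 2))"
      by (intro Bochner_Integration.integrable_diff integrable_mult_right integrable_divide_zero Bochner_Integration.integrable_add shifted_weight s)
    show "integrable lborel (\<lambda>\<xi>::'a. (1 + norm \<xi>) powr s * tensor v \<xi> - k powr (s - 2) / 4 * tensor v \<xi>)"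
      by (intro Bochner_Integration.integrable_diff integrable_mult_right integrable_weight_tensor it s)
    fix \<xi> :: 'a
    have ne: "norm e = 1" using e by simp
    have n1: "norm (\<xi> + e) powr s \<le> (1 + norm \<xi>) powr s" "norm (\<xi> + - e) powr s \<le> (1 + norm \<xi>) powr s"
      using s ne norm_triangle_ineq[of \<xi> e] norm_triangle_ineq[of \<xi> "- e"] by (auto intro!: powr_mono2)
    \<comment> \<open>The points \<open>xi + k e\<close> and \<open>xi - k e\<close> are 2k apart,
      so one of them has norm at least k. Keeping only that one leaves half of
      \<open>k powr s\<close> in the average, and with the coefficient \<open>1 / (2 * k^2)\<close>
      this becomes \<open>k powr (s - 2) / 4\<close>.\<close>
    have n2: "k powr s \<le> norm (\<xi> + k *\<^sub>R e) powr s + norm (\<xi> + - (k *\<^sub>R e)) powr s"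
    proof -
      have "norm ((\<xi> + k *\<^sub>R e) - (\<xi> + - (k *\<^sub>R e))) \<le> norm (\<xi> + k *\<^sub>R e) + norm (\<xi> + - (k *\<^sub>R e))"
        by (rule norm_triangle_ineq4)
      moreover have "(\<xi> + k *\<^sub>R e) - (\<xi> + - (k *\<^sub>R e)) = (2 * k) *\<^sub>R e"
        by (simp add: algebra_simps flip: scaleR_2)
      ultimately have "2 * k \<le> norm (\<xi> + k *\<^sub>R e) + norm (\<xi> + - (k *\<^sub>R e))" using k ne by simp
      then consider "k \<le> norm (\<xi> + k *\<^sub>R e)" | "k \<le> norm (\<xi> + - (k *\<^sub>R e))" by linarith
      then show ?thesis
      proof cases
        case 1 then have "k powr s \<le> norm (\<xi> + k *\<^sub>R e) powr s" using k s by (intro powr_mono2) auto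
        then show ?thesis using powr_ge_zero[of "norm (\<xi> + - (k *\<^sub>R e))" s] by linarith
      next
        case 2 then have "k powr s \<le> norm (\<xi> + - (k *\<^sub>R e)) powr s" using k s by (intro powr_mono2) auto
        then show ?thesis using powr_ge_zero[of "norm (\<xi> + k *\<^sub>R e)" s] by linarith
      qed
    qed
    have "(norm (\<xi> + e) powr s + norm (\<xi> + - e) powr s) / 2 - 1 / (2 * k\<^sup>2) * ((norm (\<xi> + k *\<^sub>R e) powr s + norm (\<xi> + - (k *\<^sub>R e)) powr s) / 2)
        \<le> (1 + norm \<xi>) powr s - 1 / (2 * k\<^sup>2) * (k powr s / 2)"
      using n1 n2 by (intro diff_mono mult_left_mono) auto
    also have "1 / (2 * k\<^sup>2) * (k powr s / 2) = k powr (s - 2) / 4"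
      using k by (simp add: powr_diff)
    finally have "((norm (\<xi> + e) powr s + norm (\<xi> + - e) powr s) / 2 - 1 / (2 * k\<^sup>2) * ((norm (\<xi> + k *\<^sub>R e) powr s + norm (\<xi> + - (k *\<^sub>R e)) powr s) / 2)) * tensor v \<xi>
        \<le> ((1 + norm \<xi>) powr s - k powr (s - 2) / 4) * tensor v \<xi>"
      by (rule mult_right_mono[OF _ tensor_v_nonneg])
    moreover have "(a * T + b * T) / 2 - q * ((c * T + d * T) / 2) \<le> x * T - y * T"
      if "((a + b) / 2 - q * ((c + d) / 2)) * T \<le> (x - y) * T" for a b c d q x y T :: real
      using that by (simp add: algebra_simps add_divide_distrib)
    ultimately show "(?J e \<xi> + ?J (- e) \<xi>) / 2 - 1 / (2 * k\<^sup>2) * ((?J (k *\<^sub>R e) \<xi> + ?J (- (k *\<^sub>R e)) \<xi>) / 2)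
       \<le> (1 + norm \<xi>) powr s * tensor v \<xi> - k powr (s - 2) / 4 * tensor v \<xi>"
      by blast
  qed
  also have "\<dots> = (\<integral>\<xi>. (1 + norm (\<xi>::'a)) powr s * tensor v \<xi> \<partial>lborel) - k powr (s - 2) / 4 * (\<integral>\<xi>. tensor v (\<xi>::'a) \<partial>lborel)"
    using integrable_weight_tensor[OF s] it by simp
  finally show ?thesis .
qed

text \<open>At the origin the exponential of the inverse transform is 1 and \<open>wave_hat\<close>
  is real, so a plain weighted integral of the spectrum remains.\<close>

lemma frac_lap_wave_0:
  "frac_lap s (wave u e k) 0 = (\<integral>\<xi>. norm \<xi> powr s * wave_hat v e k \<xi> \<partial>lborel) / (2 * pi) ^ DIM('a)"
proof -
  have "frac_lap s (wave u e k) 0 = Re (complex_of_real (\<integral>\<xi>. norm \<xi> powr s * wave_hat v e k \<xi> \<partial>lborel) / complex_of_real ((2 * pi) ^ DIM('a)))"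
    unfolding frac_lap_def fourier_wave integral_complex_of_real[symmetric] by simp
  then show ?thesis by (simp only: of_real_divide[symmetric] Re_complex_of_real)
qed

lemma wave_decay: obtains B where "\<And>x. norm x * \<bar>wave u e k x\<bar> \<le> B"
proof -
  have "schwartz (\<lambda>x. wave u e k (1 *\<^sub>R x))" by (intro schwartz_wave profile_schwartz1 e) simp
  \<comment> \<open>The first moment without derivatives: m = 1 and the empty list in the definition
    of \<open>schwartz\<close>.\<close>
  then have "bounded (range (\<lambda>x. norm x ^ 1 * iter_deriv [] (wave u e k) x))"
    unfolding schwartz_def by (metis (no_types, lifting) empty_subsetI ext list.set(1) scaleR_one)
  then show ?thesis using that by (auto simp: bounded_iff abs_mult)
qed

text \<open>One nonzero coordinate contributes a strictly smaller factor; the others are at most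
  \<open>u 0\<close>, which is positive.\<close>

lemma tensor_strict_max:
  assumes "x \<noteq> (0::'a)" shows "\<bar>tensor u x\<bar> < tensor u (0::'a)"
proof -
  have u1: "\<bar>u t\<bar> < u 0" if "t \<noteq> 0" for t using p that by (simp add: profile_def)
  have u0: "u 0 > 0" using u1[of 1] by simp
  have u2: "\<bar>u t\<bar> \<le> u 0" for t using u1[of t] u0 by (cases "t = 0") auto
  obtain b where b: "b \<in> Basis" "x \<bullet> b \<noteq> 0" using assms by (metis euclidean_all_zero_iff)
  have "\<bar>tensor u x\<bar> = \<bar>u (x \<bullet> b)\<bar> * (\<Prod>c\<in>Basis - {b}. \<bar>u (x \<bullet> c)\<bar>)"
    using b by (simp add: tensor_def abs_prod abs_mult prod.remove[of Basis b])
  also have "\<dots> \<le> \<bar>u (x \<bullet> b)\<bar> * (\<Prod>c\<in>Basis - {b}. u 0)"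
    by (intro mult_left_mono prod_mono) (auto simp: u2)
  also have "\<dots> < u 0 * (\<Prod>c\<in>Basis - {b}. u 0)"
    using u0 u1[OF b(2)] by (intro mult_strict_right_mono) auto
  also have "\<dots> = tensor u (0::'a)"
    using b by (simp add: tensor_def card_gt_0_iff flip: power_Suc)
  finally show ?thesis .
qed

end

section \<open>Negativity at the origin and of the integral\<close>

lemma frac_lap_wave_0_neg:
  fixes e :: "'a::euclidean_space"
  assumes p: "profile u v" and e: "e \<in> Basis" and s: "s > 2"
  obtains n where "odd n" "frac_lap s (wave u e (real n)) 0 < 0"
proof -
  define A where "A = (\<integral>\<xi>. (1 + norm (\<xi>::'a)) powr s * tensor v \<xi> \<partial>lborel)"
  define B where "B = (\<integral>\<xi>. tensor v (\<xi>::'a) \<partial>lborel)"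
  have cv: "continuous_on UNIV v" and rv: "rapid v" and nn: "\<And>t. v t \<ge> 0" and v0: "v 0 > 0"
    using p by (auto simp: profile_def)
  have "integrable lborel (tensor v :: 'a \<Rightarrow> real)"
    unfolding tensor_def[abs_def] by (rule lborel_integral_prod_Basis(1)[of "\<lambda>_. v"]) (intro rapid_integrable rv cv)
  moreover have "tensor v (0::'a) > 0" "tensor v \<xi> \<ge> 0" for \<xi> :: 'a
    by (auto simp: tensor_def v0 intro!: prod_nonneg nn)
  ultimately have B: "B > 0"
    unfolding B_def by (intro integral_continuous_pos[where ?x0.0=0] continuous_on_tensor cv)
  have "LIM x at_top. x powr (s - 2) :: real :> at_top" using s by real_asymp
  then have "\<forall>\<^sub>F x in at_top. x powr (s - 2) > 4 * A / B" by (simp add: filterlim_at_top_dense)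
  then obtain x0 :: real where x0: "\<And>x. x \<ge> x0 \<Longrightarrow> x powr (s - 2) > 4 * A / B"
    by (auto simp: eventually_at_top_linorder)
  \<comment> \<open>Odd, for the sign symmetry of the carrier, and at least x0, so that the growing
    term outweighs A.\<close>
  define n where "n = 2 * nat \<lceil>x0\<rceil> + 1"
  have "real n \<ge> x0" unfolding n_def using real_nat_ceiling_ge[of x0] by linarith
  then have "real n powr (s - 2) > 4 * A / B" by (rule x0)
  then have neg: "A - real n powr (s - 2) / 4 * B < 0" using B by (simp add: field_simps)
  have n1: "real n \<ge> 1" by (simp add: n_def)
  have "frac_lap s (wave u e (real n)) 0 = (\<integral>\<xi>. norm \<xi> powr s * wave_hat v e (real n) \<xi> \<partial>lborel) / (2 * pi) ^ DIM('a)"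
    by (rule frac_lap_wave_0[OF p e n1])
  also have "\<dots> < 0"
    using integral_weight_wave_hat_le[OF p e n1, of s] s neg
    by (intro divide_neg_pos) (auto simp: A_def B_def)
  finally show ?thesis by (rule that[rotated]) (simp add: n_def)
qed

text \<open>The hypotheses of \<open>concentration_at_maximum\<close> are assembled for one fixed k,
  so that p0 is chosen before p. The bounds on the wave and the continuity of its fractional
  Laplacian are exported for the rescaling argument.\<close>

lemma negative_wave_exists:
  fixes e :: "'a::euclidean_space"
  assumes p: "profile u v" and e: "e \<in> Basis" and s: "s > 2"
  obtains k p0 where "k \<ge> 1" "p0 > 2" "wave u e k 0 > 0" "\<And>x. \<bar>wave u e k x\<bar> \<le> wave u e k 0"
    "continuous_on UNIV (frac_lap s (wave u e k))"
    "\<And>p. p \<ge> p0 \<Longrightarrow> (\<integral>x. frac_lap s (wave u e k) x * (\<bar>wave u e k x\<bar> powr (p - 2)) * wave u e k x \<partial>lborel) < 0"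
proof -
  obtain n where n: "odd n" "frac_lap s (wave u e (real n)) 0 < 0"
    using frac_lap_wave_0_neg[OF assms] by blast
  define k where "k = real n"
  have n0: "n > 0" using n by (auto intro: Nat.gr0I)
  then have k: "k \<ge> 1" by (simp add: k_def)
  let ?g = "wave u e k"
  have T: "\<bar>tensor u x\<bar> < tensor u (0::'a)" if "x \<noteq> 0" for x :: 'a
    by (rule tensor_strict_max[OF p e k that])
  \<comment> \<open>A weak inequality from the carrier times a strict one from the envelope;
    positivity of \<open>carrier_wave k 0\<close> preserves strictness.\<close>
  have mx: "\<bar>?g x\<bar> < ?g 0" if "x \<noteq> 0" for x
  proof -
    have "\<bar>?g x\<bar> = \<bar>carrier_wave k (x \<bullet> e)\<bar> * \<bar>tensor u x\<bar>" by (simp add: wave_def abs_mult)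
    also have "\<dots> \<le> carrier_wave k 0 * \<bar>tensor u x\<bar>"
      unfolding k_def by (intro mult_right_mono abs_carrier_wave_le n) auto
    also have "\<dots> < carrier_wave k 0 * tensor u (0::'a)"
      unfolding k_def by (intro mult_strict_left_mono T that carrier_wave_0_pos n0)
    finally show ?thesis by (simp add: wave_def)
  qed
  have "e \<noteq> 0" using e by auto
  from mx[OF this] have g0: "?g 0 > 0" by linarith
  have i: "integrable lborel (\<lambda>\<xi>. complex_of_real (norm \<xi> powr s) * fourier ?g \<xi>)"
    unfolding fourier_wave[OF p e k] of_real_mult[symmetric]
    using integrable_weight_wave_hat[OF p e k, of s] s by (intro integrable_of_real) auto
  obtain K where K: "\<And>x. \<bar>frac_lap s ?g x\<bar> \<le> K" using frac_lap_continuous_bounded(2)[OF i] by blast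
  note cL = frac_lap_continuous_bounded(1)[OF i]
  obtain B where B: "\<And>x. norm x * \<bar>?g x\<bar> \<le> B" using wave_decay[OF p e k] by blast
  obtain p0 where p0: "p0 > 2" "\<And>p. p \<ge> p0 \<Longrightarrow> (\<integral>x. frac_lap s ?g x * (\<bar>?g x\<bar> powr (p - 2)) * ?g x \<partial>lborel) < 0"
    using concentration_at_maximum[OF continuous_on_wave[OF p e k] integrable_wave[OF p e k] B mx cL K n(2)[folded k_def]]
    by blast
  show ?thesis
  proof (rule that[OF k p0(1) g0 _ cL p0(2)])
    show "\<bar>?g x\<bar> \<le> ?g 0" for x using mx[of x] g0 by (cases "x = 0") auto
  qed
qed

section \<open>Supports in space and in frequency\<close>

lemma Cc_infty_wave:
  fixes e :: "'a::euclidean_space"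
  assumes p: "profile u v" and t: "test1 u" and e: "e \<in> Basis"
  shows "Cc_infty (wave u e k)"
proof -
  have "schwartz (\<lambda>x. wave u e k (1 *\<^sub>R x))"
    by (rule schwartz_wave) (use p e in \<open>auto simp: profile_def\<close>)
  then have "smooth_fun (wave u e k)" by (simp add: schwartz_def)
  moreover obtain R where R: "\<And>t. \<bar>t\<bar> > R \<Longrightarrow> u t = 0" using t by (auto simp: test1_def)
  have "norm x \<le> real DIM('a) * R" if "wave u e k x \<noteq> 0" for x
  proof -
    have "\<bar>x \<bullet> b\<bar> \<le> R" if "b \<in> Basis" for b
    proof (rule ccontr)
      assume "\<not> \<bar>x \<bullet> b\<bar> \<le> R"
      then have "u (x \<bullet> b) = 0" by (intro R) auto
      with that have "tensor u x = 0" by (auto simp: tensor_def)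
      with \<open>wave u e k x \<noteq> 0\<close> show False by (simp add: wave_def)
    qed
    then have "(\<Sum>b\<in>Basis. \<bar>x \<bullet> b\<bar>) \<le> (\<Sum>b\<in>(Basis::'a set). R)" by (intro sum_mono)
    with norm_le_l1[of x] show ?thesis by simp
  qed
  then have "bounded {x. wave u e k x \<noteq> 0}" by (auto simp: bounded_iff)
  then have "compact (fsupport (wave u e k))" by (simp add: fsupport_def compact_closure)
  ultimately show ?thesis by (simp add: Cc_infty_def)
qed

text \<open>The spectrum lies in cubes of half-side 1/2 around the points c e with c = 1, -1, k, -k.
  In the direction e they stay at distance 1 - 1/2 from 0; for the upper bound each coordinate of
  the offset is estimated crudely by 1.\<close>

lemma wave_hat_support:
  fixes e \<xi> :: "'a::euclidean_space"
  assumes v: "\<And>t. \<bar>t\<bar> > 1/2 \<Longrightarrow> v t = 0" and e: "e \<in> Basis" and k: "k \<ge> 1"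
    and nz: "wave_hat v e k \<xi> \<noteq> 0"
  shows "1/2 \<le> norm \<xi>" "norm \<xi> \<le> k + real DIM('a)"
proof -
  have T: "\<bar>\<eta> \<bullet> b\<bar> \<le> 1/2" if "tensor v \<eta> \<noteq> 0" "b \<in> Basis" for \<eta> b :: 'a
  proof (rule ccontr)
    assume "\<not> \<bar>\<eta> \<bullet> b\<bar> \<le> 1/2"
    then have "v (\<eta> \<bullet> b) = 0" by (intro v) auto
    with that show False by (auto simp: tensor_def)
  qed
  have "\<exists>c. 1 \<le> \<bar>c\<bar> \<and> \<bar>c\<bar> \<le> k \<and> tensor v (\<xi> - c *\<^sub>R e) \<noteq> 0"
  proof (rule ccontr)
    assume "\<not> ?thesis"
    then have z: "tensor v (\<xi> - c *\<^sub>R e) = 0" if "1 \<le> \<bar>c\<bar>" "\<bar>c\<bar> \<le> k" for c using that by blast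
    show False using nz z[of 1] z[of "-1"] z[of k] z[of "-k"] k by (simp add: wave_hat_def)
  qed
  then obtain c where c: "1 \<le> \<bar>c\<bar>" "\<bar>c\<bar> \<le> k" "tensor v (\<xi> - c *\<^sub>R e) \<noteq> 0" by blast
  have "\<bar>\<xi> \<bullet> e - c\<bar> \<le> 1/2" using T[OF c(3) e] e by (simp add: inner_diff_left)
  then have "1/2 \<le> \<bar>\<xi> \<bullet> e\<bar>" using c(1) by linarith
  then show "1/2 \<le> norm \<xi>" using Basis_le_norm[OF e, of \<xi>] by linarith
  have "(\<Sum>b\<in>Basis. \<bar>(\<xi> - c *\<^sub>R e) \<bullet> b\<bar>) \<le> (\<Sum>b\<in>(Basis::'a set). 1)"
    using T[OF c(3)] by (intro sum_mono) force
  then have "norm (\<xi> - c *\<^sub>R e) \<le> real DIM('a)" using norm_le_l1[of "\<xi> - c *\<^sub>R e"] by simp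
  moreover have "norm \<xi> \<le> norm (\<xi> - c *\<^sub>R e) + norm (c *\<^sub>R e)"
    using norm_triangle_ineq[of "\<xi> - c *\<^sub>R e" "c *\<^sub>R e"] by simp
  ultimately show "norm \<xi> \<le> k + real DIM('a)" using c(2) e by simp
qed

theorem theorem3p4:
  fixes s :: real
  assumes "s > 2"
  shows "\<exists>p0 > 2. \<forall>p \<ge> p0.
    (\<exists>C > 0. \<exists>f :: 'a::euclidean_space \<Rightarrow> real. Cc_infty f \<and>
        (\<integral>x. frac_lap s f x * (\<bar>f x\<bar> powr (p - 2)) * f x \<partial>lborel) \<le> - C)
  \<and> (\<exists>D1 D2 \<alpha>1 \<alpha>2. D1 > 0 \<and> D2 > 0 \<and> \<alpha>1 > 0 \<and> \<alpha>2 > 0 \<and>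
       (\<exists>(N :: nat \<Rightarrow> real) (fs :: nat \<Rightarrow> 'a \<Rightarrow> real).
          filterlim N at_top sequentially \<and>
          (\<forall>j. schwartz (fs j) \<and>
               fsupport (fourier (fs j)) \<subseteq> {\<xi>. \<alpha>1 * N j < norm \<xi> \<and> norm \<xi> < \<alpha>2 * N j} \<and>
               (let R = (\<integral>x. frac_lap s (fs j) x * (\<bar>fs j x\<bar> powr (p - 2)) * fs j x \<partial>lborel)
                        / (N j powr s * (\<integral>x. \<bar>fs j x\<bar> powr p \<partial>lborel))
                in - D2 < R \<and> R < - D1))))"
proof -
  obtain e :: 'a where e: "e \<in> Basis" using nonempty_Basis by blast
  obtain u1 v1 where p1: "profile u1 v1" and t1: "test1 u1" using compactly_supported_profile by blast
  obtain u v where p2: "profile u v" and v: "\<And>t. \<bar>t\<bar> > 1/2 \<Longrightarrow> v t = 0" using band_limited_profile by blast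
  obtain k1 q1 where q1: "q1 > 2"
    "\<And>p. p \<ge> q1 \<Longrightarrow> (\<integral>x. frac_lap s (wave u1 e k1) x * (\<bar>wave u1 e k1 x\<bar> powr (p - 2)) * wave u1 e k1 x \<partial>lborel) < 0"
    by (rule negative_wave_exists[OF p1 e assms]) (rule that)
  obtain k q2 where k: "k \<ge> 1" and q2: "q2 > 2" and g0: "wave u e k 0 > 0"
    and gm: "\<And>x. \<bar>wave u e k x\<bar> \<le> wave u e k 0"
    and cL: "continuous_on UNIV (frac_lap s (wave u e k))"
    and neg: "\<And>p. p \<ge> q2 \<Longrightarrow> (\<integral>x. frac_lap s (wave u e k) x * (\<bar>wave u e k x\<bar> powr (p - 2)) * wave u e k x \<partial>lborel) < 0"
    by (rule negative_wave_exists[OF p2 e assms]) (rule that)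
  define g where "g = wave u e k"
  have cg: "continuous_on UNIV g" unfolding g_def by (rule continuous_on_wave[OF p2 e k])
  have ig: "integrable lborel g" unfolding g_def by (rule integrable_wave[OF p2 e k])
  have Fg: "fourier g = (\<lambda>\<xi>. complex_of_real (wave_hat v e k \<xi>))"
    unfolding g_def by (rule ext) (rule fourier_wave[OF p2 e k])
  have m[measurable]: "g \<in> borel_measurable borel" "frac_lap s g \<in> borel_measurable borel"
    using cg cL unfolding g_def by (auto intro: borel_measurable_continuous_onI)
  have mF: "fourier g \<in> borel_measurable borel"
  proof -
    have [measurable]: "v \<in> borel_measurable borel"
      using p2 unfolding profile_def by (auto intro: borel_measurable_continuous_onI)
    show ?thesis unfolding Fg wave_hat_def tensor_def by measurable
  qed
  show ?thesis
  \<comment> \<open>Both waves are fixed by now, so the larger of their thresholds works uniformly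
    in p.\<close>
  proof (rule exI[of _ "max q1 q2"], intro conjI allI impI)
    show "max q1 q2 > 2" using q1 by simp
    fix p assume p: "p \<ge> max q1 q2"
    show "\<exists>C > 0. \<exists>f :: 'a \<Rightarrow> real. Cc_infty f \<and>
        (\<integral>x. frac_lap s f x * (\<bar>f x\<bar> powr (p - 2)) * f x \<partial>lborel) \<le> - C"
    proof (rule exI, intro conjI exI)
      show "Cc_infty (wave u1 e k1)" by (rule Cc_infty_wave[OF p1 t1 e])
      \<comment> \<open>The constant C is minus the integral itself.\<close>
      show "0 < - (\<integral>x. frac_lap s (wave u1 e k1) x * (\<bar>wave u1 e k1 x\<bar> powr (p - 2)) * wave u1 e k1 x \<partial>lborel)"
        using q1(2)[of p] p by simp
    qed simp
    let ?h = "\<lambda>x. frac_lap s g x * (\<bar>g x\<bar> powr (p - 2)) * g x"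
    define I where "I = (\<integral>x. ?h x \<partial>lborel)"
    define P where "P = (\<integral>x. \<bar>g x\<bar> powr p \<partial>lborel)"
    have I: "I < 0" unfolding I_def g_def using neg p by simp
    have P: "P > 0" unfolding P_def
    proof (rule integral_continuous_pos[where ?x0.0=0])
      have p1: "p > 1" using p q1(1) by simp
      show "continuous_on UNIV (\<lambda>x. \<bar>g x\<bar> powr p)"
        using p1 by (intro continuous_on_powr' continuous_intros cg) auto
      show "integrable lborel (\<lambda>x. \<bar>g x\<bar> powr p)"
      proof (rule Bochner_Integration.integrable_bound)
        \<comment> \<open>One factor |g| is kept for integrability; the remaining power
          \<open>p - 1\<close> is bounded through the maximum of |g|.\<close>
        show "integrable lborel (\<lambda>x. g 0 powr (p - 1) * \<bar>g x\<bar>)" using ig by auto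
        show "AE x in lborel. norm (\<bar>g x\<bar> powr p) \<le> norm (g 0 powr (p - 1) * \<bar>g x\<bar>)"
        proof (rule AE_I2)
          fix x
          have "\<bar>g x\<bar> powr p = \<bar>g x\<bar> powr (p - 1) * \<bar>g x\<bar>"
            using powr_add[of "\<bar>g x\<bar>" "p - 1" 1] by simp
          also have "\<dots> \<le> g 0 powr (p - 1) * \<bar>g x\<bar>"
            using gm[of x] p1 unfolding g_def by (intro mult_right_mono powr_mono2) auto
          finally show "norm (\<bar>g x\<bar> powr p) \<le> norm (g 0 powr (p - 1) * \<bar>g x\<bar>)" by simp
        qed
      qed measurable
    qed (use g0 in \<open>auto simp: g_def\<close>)
    \<comment> \<open>\<open>schwartz_wave\<close> asks for a dilation factor of at least 1, hence
      the shift by one.\<close>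
    define N where "N j = real (Suc j)" for j
    define fs where "fs j x = g (N j *\<^sub>R x)" for j x
    have N: "N j > 0" "N j \<ge> 1" for j by (auto simp: N_def)
    \<comment> \<open>Numerator and denominator both pick up exactly
      \<open>N j powr s / N j ^ DIM('a)\<close>, so the quotient does not depend on j.\<close>
    have ratio: "(\<integral>x. frac_lap s (fs j) x * (\<bar>fs j x\<bar> powr (p - 2)) * fs j x \<partial>lborel)
                        / (N j powr s * (\<integral>x. \<bar>fs j x\<bar> powr p \<partial>lborel)) = I / P" for j
    proof -
      have "(\<integral>x. frac_lap s (fs j) x * (\<bar>fs j x\<bar> powr (p - 2)) * fs j x \<partial>lborel)
          = (\<integral>x. N j powr s * ?h (N j *\<^sub>R x) \<partial>lborel)"
        unfolding fs_def frac_lap_scale[OF N(1) m(1) mF] by (simp only: mult.assoc)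
      also have "\<dots> = N j powr s * (\<integral>x. ?h (N j *\<^sub>R x) \<partial>lborel)" by (rule integral_mult_right_zero)
      also have "(\<integral>x. ?h (N j *\<^sub>R x) \<partial>lborel) = (1 / N j ^ DIM('a)) *\<^sub>R I"
        unfolding I_def by (rule lborel_integral_scale[OF N(1)]) measurable
      finally have 1: "(\<integral>x. frac_lap s (fs j) x * (\<bar>fs j x\<bar> powr (p - 2)) * fs j x \<partial>lborel)
          = N j powr s * ((1 / N j ^ DIM('a)) *\<^sub>R I)" .
      have 2: "(\<integral>x. \<bar>fs j x\<bar> powr p \<partial>lborel) = (1 / N j ^ DIM('a)) *\<^sub>R P"
        unfolding P_def fs_def by (rule lborel_integral_scale[OF N(1)]) measurable
      show ?thesis unfolding 1 2 using N(1)[of j] by simp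
    qed
    have supp: "fsupport (fourier (fs j)) \<subseteq> {\<xi>. 1/4 * N j < norm \<xi> \<and> norm \<xi> < (k + real DIM('a) + 1) * N j}" for j
    proof -
      \<comment> \<open>The support is a closure while the target annulus is open, so a closed shell
        is inserted between them; this is why 1/2 is weakened to 1/4 and the outer radius is
        enlarged by 1.\<close>
      let ?A = "{\<xi>::'a. 1/2 * N j \<le> norm \<xi>} \<inter> {\<xi>. norm \<xi> \<le> (k + real DIM('a)) * N j}"
      have "{\<xi>. fourier (fs j) \<xi> \<noteq> 0} \<subseteq> ?A"
      proof
        fix \<xi> assume "\<xi> \<in> {\<xi>. fourier (fs j) \<xi> \<noteq> 0}"
        then have "wave_hat v e k ((1 / N j) *\<^sub>R \<xi>) \<noteq> 0"
          unfolding fs_def fourier_scale[OF N(1) m(1)] by (auto simp: Fg)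
        from wave_hat_support[OF v e k this] N(1)[of j] show "\<xi> \<in> ?A"
          by (auto simp: field_simps)
      qed
      moreover have "closed ?A"
        by (intro closed_Int closed_Collect_le continuous_intros)
      ultimately have "fsupport (fourier (fs j)) \<subseteq> ?A"
        unfolding fsupport_def by (rule closure_minimal)
      also have "?A \<subseteq> {\<xi>. 1/4 * N j < norm \<xi> \<and> norm \<xi> < (k + real DIM('a) + 1) * N j}"
        using N(1)[of j] by (auto simp: distrib_right)
      finally show ?thesis .
    qed
    define r where "r = I / P"
    have r: "r < 0" unfolding r_def using I P by (rule divide_neg_pos)
    have sch: "schwartz (fs j)" for j
      unfolding fs_def g_def using p2 e N(2) by (intro schwartz_wave) (auto simp: profile_def)
    have lim: "filterlim N at_top sequentially"
      unfolding N_def by (intro filterlim_compose[OF filterlim_real_sequentially] filterlim_Suc)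
    show "\<exists>D1 D2 \<alpha>1 \<alpha>2. D1 > 0 \<and> D2 > 0 \<and> \<alpha>1 > 0 \<and> \<alpha>2 > 0 \<and>
       (\<exists>(N :: nat \<Rightarrow> real) (fs :: nat \<Rightarrow> 'a \<Rightarrow> real).
          filterlim N at_top sequentially \<and>
          (\<forall>j. schwartz (fs j) \<and>
               fsupport (fourier (fs j)) \<subseteq> {\<xi>. \<alpha>1 * N j < norm \<xi> \<and> norm \<xi> < \<alpha>2 * N j} \<and>
               (let R = (\<integral>x. frac_lap s (fs j) x * (\<bar>fs j x\<bar> powr (p - 2)) * fs j x \<partial>lborel)
                        / (N j powr s * (\<integral>x. \<bar>fs j x\<bar> powr p \<partial>lborel))
                in - D2 < R \<and> R < - D1)))"
    \<comment> \<open>The quotient is the constant r < 0, hence bracketed by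
      \<open>2 * r < r < r / 2\<close>.\<close>
    proof (rule exI[of _ "- r / 2"], rule exI[of _ "- (2 * r)"], rule exI[of _ "1/4"],
        rule exI[of _ "k + real DIM('a) + 1"], intro conjI)
      show "\<exists>(N :: nat \<Rightarrow> real) (fs :: nat \<Rightarrow> 'a \<Rightarrow> real).
          filterlim N at_top sequentially \<and>
          (\<forall>j. schwartz (fs j) \<and>
               fsupport (fourier (fs j)) \<subseteq> {\<xi>. 1/4 * N j < norm \<xi> \<and> norm \<xi> < (k + real DIM('a) + 1) * N j} \<and>
               (let R = (\<integral>x. frac_lap s (fs j) x * (\<bar>fs j x\<bar> powr (p - 2)) * fs j x \<partial>lborel)
                        / (N j powr s * (\<integral>x. \<bar>fs j x\<bar> powr p \<partial>lborel))
                in - (- (2 * r)) < R \<and> R < - (- r / 2)))"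
        unfolding Let_def
      proof (rule exI[of _ N], rule exI[of _ fs], intro conjI allI)
        fix j
        show "- (- (2 * r)) < (\<integral>x. frac_lap s (fs j) x * (\<bar>fs j x\<bar> powr (p - 2)) * fs j x \<partial>lborel)
                        / (N j powr s * (\<integral>x. \<bar>fs j x\<bar> powr p \<partial>lborel))"
          unfolding ratio r_def[symmetric] using r by linarith
        show "(\<integral>x. frac_lap s (fs j) x * (\<bar>fs j x\<bar> powr (p - 2)) * fs j x \<partial>lborel)
                        / (N j powr s * (\<integral>x. \<bar>fs j x\<bar> powr p \<partial>lborel)) < - (- r / 2)"
          unfolding ratio r_def[symmetric] using r by linarith
      qed (use lim sch supp in auto)
      show "k + real DIM('a) + 1 > 0" using k by linarith
    qed (use r in linarith)+
  qed
qed

end
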